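(* Let $\theta$ be an aperiodic primitive block substitution on $\mathbb{Z}^d$ with trivial height lattice (i.e. $\Gamma=\mathbb{Z}^d$). Then there exists a sofic shift $\mathcal{Z}_\theta$ such that $\boldsymbol z\in\mathbb{A}=\mathbb{Z}^d_Q$ corresponds to an irregular fibre if, and only if, $\boldsymbol z+\boldsymbol n\in\mathcal{Z}_\theta$ for some $\boldsymbol n\in\mathbb{Z}^d$.
   Context: Block substitutions: $\mathcal{A}$ is a finite alphabet, $Q=\mathrm{diag}(\ell_1,\dots,\ell_d)$ with integers $\ell_j\ge2$, $R=\prod_{j=1}^d\{0,\dots,\ell_j-1\}$, and $\theta\colon\mathcal{A}\to\mathcal{A}^R$, with columns $\theta_{\boldsymbol j}(a)=\theta(a)_{\boldsymbol j}$. The power $\theta^n$ has support $\prod_j\{0,\dots,\ell_j^n-1\}$ and columns $\theta^n_{\boldsymbol j}=\theta_{\boldsymbol j_0}\circ\cdots\circ\theta_{\boldsymbol j_{n-1}}$ for $\boldsymbol j=\sum_{i<n}Q^i\boldsymbol j_i$, $\boldsymbol j_i\in R$; on configurations, $\theta(x)_{Q\boldsymbol m+\boldsymbol j}=\theta_{\boldsymbol j}(x_{\boldsymbol m})$ for $\boldsymbol m\in\mathbb{Z}^d$, $\boldsymbol j\in R$. $\mathbb{X}_\theta\subseteq\mathcal{A}^{\mathbb{Z}^d}$ is the subshift whose language consists of the finite patterns occurring (up to translation) in some $\theta^k(a)$ (assumed well defined). $\theta$ is primitive if for some $k$ every $\theta^k(a)$ contains all letters, and aperiodic if no element of $\mathbb{X}_\theta$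 has a non-zero period. The column number is $c_\theta=\min_{k\ge1}\min_{\boldsymbol j\in\mathrm{supp}(\theta^k)}|\theta^k_{\boldsymbol j}(\mathcal{A})|$. The shift is $\sigma_{\boldsymbol n}(x)_{\boldsymbol i}=x_{\boldsymbol i+\boldsymbol n}$. Height lattice: for $x\in\mathbb{X}_\theta$ let $\mathcal{L}$ be the subgroup of $\mathbb{Z}^d$ generated by all $\boldsymbol j$ for which there is $\boldsymbol k$ with $x_{\boldsymbol j+\boldsymbol k}=x_{\boldsymbol k}$ (independent of $x$). The height lattice $\Gamma$ is the smallest sublattice of $\mathbb{Z}^d$ which contains $\mathcal{L}$ and satisfies $\Gamma+Q^k\mathbb{Z}^d=\mathbb{Z}^d$ for all $k\ge1$. MEF and fibres: $\mathbb{Z}^d_Q=\varprojlim\mathbb{Z}^d/Q^k\mathbb{Z}^d$ is the $Q$-adic odometer; its elements are identified with sequences $(\boldsymbol n_k)_{k\ge0}\in R^{\mathbb{N}}$ of digits, via $\boldsymbol z=\sum_{k\ge0}Q^k\boldsymbol n_k$, and $\mathbb{Z}^d\subset\mathbb{Z}^d_Q$. By recognisability, for each $x\in\mathbb{X}_\theta$ and $k$ there are unique $y\in\mathbb{X}_\theta$, $\boldsymbol j_k\in\mathrm{supp}(\theta^k)$ with $x=\sigma_{\boldsymbol j_k}\theta^k(y)$; the factor map $\pi\colon\mathbb{X}_\theta\to\mathbb{Z}^d_Q$ is defined by $\pi(x)\equiv\boldsymbol j_k\pmod{Q^k\mathbb{Z}^d}$ for all $k$. When the height lattice is trivial this is the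 maximal equicontinuous factor map $\pi_{\rm MEF}$ onto $\mathbb{A}=\mathbb{Z}_Q^d$. A point $\boldsymbol z\in\mathbb{A}$ corresponds to an irregular fibre if $|\pi^{-1}(\boldsymbol z)|>c_\theta$. Here a sofic shift means a one-sided sofic shift over the alphabet $R$, i.e. the set of label sequences in $R^{\mathbb{N}}$ of infinite paths in a finite directed graph with edges labelled by elements of $R$; its points are identified with points of $\mathbb{Z}_Q^d$ via the digit identification above. *)

theory Defs
  imports
    "HOL-Analysis.Finite_Cartesian_Product"
    "HOL-Library.Set_Algebras"
    "HOL-Computational_Algebra.Group_Closure"
begin

text \<open>
  Points of \<open>\<int>\<^sup>d\<close> are vectors \<open>int ^ 'd\<close>. The matrix \<open>Q = diag(\<ell>\<^sub>1, \<dots>, \<ell>\<^sub>d)\<close> is given by the vector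
  \<open>l\<close> of its diagonal entries: multiplication on \<open>int ^ 'd\<close> is componentwise, so \<open>l ^ k * m\<close> is
  \<open>Q\<^sup>k m\<close>.

  A block substitution is a function \<open>\<theta>\<close> with \<open>\<theta> a j = \<theta>(a)\<^sub>j\<close>. Only its values at
  \<open>j \<in> R = block l 1\<close> matter; every definition below evaluates it there only.
\<close>

definition block :: "int ^ 'd \<Rightarrow> nat \<Rightarrow> (int ^ 'd) set" where
  "block l k = {j. \<forall>i. 0 \<le> j $ i \<and> j $ i < (l $ i) ^ k}"

definition Q_lattice :: "int ^ 'd \<Rightarrow> nat \<Rightarrow> (int ^ 'd) set" where
  "Q_lattice l k = range (\<lambda>m. l ^ k * m)"

definition Q_div :: "int ^ 'd \<Rightarrow> int ^ 'd \<Rightarrow> int ^ 'd" where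
  "Q_div l p = (\<chi> i. p $ i div l $ i)"

definition Q_mod :: "int ^ 'd \<Rightarrow> int ^ 'd \<Rightarrow> int ^ 'd" where
  "Q_mod l p = (\<chi> i. p $ i mod l $ i)"

text \<open>
  \<open>col l \<theta> k j\<close> is the column \<open>\<theta>\<^sup>k\<^sub>j\<close>, for \<open>j \<in> block l k\<close>. If \<open>j = (\<Sum>i<k. Q\<^sup>i j\<^sub>i)\<close> with
  \<open>j\<^sub>i \<in> R\<close>, then \<open>Q_mod l j = j\<^sub>0\<close> and \<open>Q_div l j\<close> has the digits \<open>j\<^sub>1, \<dots>, j\<^bsub>k-1\<^esub>\<close>, so that the
  recursion unfolds to \<open>\<theta>\<^bsub>j\<^sub>0\<^esub> \<circ> \<dots> \<circ> \<theta>\<^bsub>j\<^bsub>k-1\<^esub>\<^esub>\<close>.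
\<close>

primrec col :: "int ^ 'd \<Rightarrow> ('a \<Rightarrow> int ^ 'd \<Rightarrow> 'a) \<Rightarrow> nat \<Rightarrow> int ^ 'd \<Rightarrow> 'a \<Rightarrow> 'a" where
  "col l \<theta> 0 j = id"
| "col l \<theta> (Suc k) j = (\<lambda>a. \<theta> a (Q_mod l j)) \<circ> col l \<theta> k (Q_div l j)"

definition subst_conf ::
    "int ^ 'd \<Rightarrow> ('a \<Rightarrow> int ^ 'd \<Rightarrow> 'a) \<Rightarrow> (int ^ 'd \<Rightarrow> 'a) \<Rightarrow> int ^ 'd \<Rightarrow> 'a" where
  "subst_conf l \<theta> x = (\<lambda>p. \<theta> (x (Q_div l p)) (Q_mod l p))"

definition shift :: "int ^ 'd \<Rightarrow> (int ^ 'd \<Rightarrow> 'a) \<Rightarrow> int ^ 'd \<Rightarrow> 'a" where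
  "shift n x = (\<lambda>i. x (i + n))"

definition subst_shift :: "int ^ 'd \<Rightarrow> ('a \<Rightarrow> int ^ 'd \<Rightarrow> 'a) \<Rightarrow> (int ^ 'd \<Rightarrow> 'a) set" where
  "subst_shift l \<theta> =
    {x. \<forall>F. finite F \<longrightarrow> (\<exists>k a t. \<forall>i\<in>F. i + t \<in> block l k \<and> x i = col l \<theta> k (i + t) a)}"

definition primitive :: "int ^ 'd \<Rightarrow> ('a \<Rightarrow> int ^ 'd \<Rightarrow> 'a) \<Rightarrow> bool" where
  "primitive l \<theta> \<longleftrightarrow> (\<exists>k. \<forall>a b. \<exists>j\<in>block l k. col l \<theta> k j a = b)"

definition aperiodic :: "int ^ 'd \<Rightarrow> ('a \<Rightarrow> int ^ 'd \<Rightarrow> 'a) \<Rightarrow> bool" where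
  "aperiodic l \<theta> \<longleftrightarrow> (\<forall>x\<in>subst_shift l \<theta>. \<forall>p. shift p x = x \<longrightarrow> p = 0)"

definition column_number :: "int ^ 'd \<Rightarrow> ('a \<Rightarrow> int ^ 'd \<Rightarrow> 'a) \<Rightarrow> nat" where
  "column_number l \<theta> = Inf {card (range (col l \<theta> k j)) | k j. 1 \<le> k \<and> j \<in> block l k}"

definition return_lattice :: "(int ^ 'd \<Rightarrow> 'a) \<Rightarrow> (int ^ 'd) set" where
  "return_lattice x = group_closure {j. \<exists>k. x (j + k) = x k}"

text \<open>Sublattices of \<open>\<int>\<^sup>d\<close> are its subgroups, i.e. the sets \<open>\<Gamma>\<close> with \<open>group_closure \<Gamma> = \<Gamma>\<close>.\<close>

definition height_admissible :: "int ^ 'd \<Rightarrow> (int ^ 'd \<Rightarrow> 'a) \<Rightarrow> (int ^ 'd) set \<Rightarrow> bool" where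
  "height_admissible l x \<Gamma> \<longleftrightarrow>
    group_closure \<Gamma> = \<Gamma> \<and> return_lattice x \<subseteq> \<Gamma> \<and> (\<forall>k\<ge>1. \<Gamma> + Q_lattice l k = UNIV)"

definition is_height_lattice :: "int ^ 'd \<Rightarrow> (int ^ 'd \<Rightarrow> 'a) \<Rightarrow> (int ^ 'd) set \<Rightarrow> bool" where
  "is_height_lattice l x \<Gamma> \<longleftrightarrow>
    height_admissible l x \<Gamma> \<and> (\<forall>\<Gamma>'. height_admissible l x \<Gamma>' \<longrightarrow> \<Gamma> \<subseteq> \<Gamma>')"

text \<open>
  An element of the inverse limit of the groups \<open>\<int>\<^sup>d / Q\<^sup>k \<int>\<^sup>d\<close> is a compatible sequence of cosets;
  the bonding map sends a coset of \<open>Q\<^bsup>k+1\<^esup> \<int>\<^sup>d\<close> to the coset of \<open>Q\<^sup>k \<int>\<^sup>d\<close> that contains it.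
\<close>

definition odometer :: "int ^ 'd \<Rightarrow> (nat \<Rightarrow> (int ^ 'd) set) set" where
  "odometer l = {z. \<forall>k. (\<exists>m. z k = m +o Q_lattice l k) \<and> z (Suc k) \<subseteq> z k}"

definition odometer_translate ::
    "(nat \<Rightarrow> (int ^ 'd) set) \<Rightarrow> int ^ 'd \<Rightarrow> nat \<Rightarrow> (int ^ 'd) set" where
  "odometer_translate z n = (\<lambda>k. n +o z k)"

definition of_digits :: "int ^ 'd \<Rightarrow> (nat \<Rightarrow> int ^ 'd) \<Rightarrow> nat \<Rightarrow> (int ^ 'd) set" where
  "of_digits l w = (\<lambda>k. (\<Sum>i<k. l ^ i * w i) +o Q_lattice l k)"

text \<open>
  The description operator below is meaningful because of recognisability: for an aperiodic primitive
  \<open>\<theta>\<close> and \<open>x \<in> subst_shift l \<theta>\<close> there is exactly one such \<open>j\<close>.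
\<close>

definition odometer_map ::
    "int ^ 'd \<Rightarrow> ('a \<Rightarrow> int ^ 'd \<Rightarrow> 'a) \<Rightarrow> (int ^ 'd \<Rightarrow> 'a) \<Rightarrow> nat \<Rightarrow> (int ^ 'd) set" where
  "odometer_map l \<theta> x = (\<lambda>k.
    (THE j. j \<in> block l k \<and> (\<exists>y\<in>subst_shift l \<theta>. x = shift j ((subst_conf l \<theta> ^^ k) y)))
      +o Q_lattice l k)"

definition fibre ::
    "int ^ 'd \<Rightarrow> ('a \<Rightarrow> int ^ 'd \<Rightarrow> 'a) \<Rightarrow> (nat \<Rightarrow> (int ^ 'd) set) \<Rightarrow> (int ^ 'd \<Rightarrow> 'a) set" where
  "fibre l \<theta> z = {x \<in> subst_shift l \<theta>. odometer_map l \<theta> x = z}"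

text \<open>\<open>card\<close> is \<open>0\<close> on infinite sets, so an infinite fibre has to be counted as irregular separately.\<close>

definition irregular :: "int ^ 'd \<Rightarrow> ('a \<Rightarrow> int ^ 'd \<Rightarrow> 'a) \<Rightarrow> (nat \<Rightarrow> (int ^ 'd) set) \<Rightarrow> bool" where
  "irregular l \<theta> z \<longleftrightarrow> infinite (fibre l \<theta> z) \<or> card (fibre l \<theta> z) > column_number l \<theta>"

text \<open>
  A finite labelled graph is a finite set of triples (source, label, target). Vertices are taken in
  \<open>nat\<close>, which covers every finite graph up to isomorphism.
\<close>

definition path_labels :: "('v \<times> 'b \<times> 'v) set \<Rightarrow> (nat \<Rightarrow> 'b) set" where
  "path_labels E = {w. \<exists>v. \<forall>k. (v k, w k, v (Suc k)) \<in> E}"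

definition sofic :: "'b set \<Rightarrow> (nat \<Rightarrow> 'b) set \<Rightarrow> bool" where
  "sofic B S \<longleftrightarrow>
    (\<exists>E :: (nat \<times> 'b \<times> nat) set. finite E \<and> (\<forall>(u, b, v)\<in>E. b \<in> B) \<and> S = path_labels E)"

end

theory Submission
  imports Defs
begin

text \<open>
  A point \<open>x\<close> of the shift \<open>X\<close> lies over the odometer point with digits \<open>n\<^sub>0, n\<^sub>1, \<dots>\<close> iff it can be
  desubstituted to all levels with these digits as offsets. The fibre over a digit sequence is thus
  a kind of inverse limit along the maps \<open>\<sigma>\<^bsub>n\<^sub>k\<^esub> \<circ> \<theta>\<close>. A finite window carries this inverse limit: on
  the cube \<open>{-1, 0, 1}\<^sup>d\<close> of cells, the pattern of \<open>\<sigma>\<^sub>n \<theta>(y)\<close> is determined by the pattern of \<open>y\<close>,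
  and any finite set of positions is eventually covered by such a cube of level \<open>k\<close> cells.

  Consider the finite graph whose vertices are the sets of \<open>c\<^sub>\<theta> + 1\<close> patterns of \<open>X\<close> on the cube and
  whose edges, labelled by \<open>n \<in> R\<close>, join \<open>P\<close> to \<open>P'\<close> if \<open>\<sigma>\<^sub>n \<circ> \<theta>\<close> maps \<open>P'\<close> onto \<open>P\<close>. Its path labels are
  the sofic shift. If a digit sequence labels a path, each pattern of the first vertex extends to a
  point of the fibre by compactness (\<open>path_gives_fibre_point\<close>), so that the fibre has more than
  \<open>c\<^sub>\<theta>\<close> points. Conversely, \<open>c\<^sub>\<theta> + 1\<close> points of a fibre have preimages with distinct patterns on the
  cube from some level \<open>k\<close> on, so the digits from \<open>k\<close> on label a path
  (\<open>fibre_points_give_path\<close>). This path returns to some vertex, and running backwards through the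
  cycle provides a prefix of any length (\<open>path_labels_from_tail\<close>). Replacing the lower digits by such
  a prefix amounts to a translation by an element of \<open>\<int>\<^sup>d\<close> (\<open>change_digits\<close>), under which
  irregularity is invariant.

  All this presupposes that the offsets of a point are determined by the point, that is,
  recognisability. Call \<open>j\<close> a coincidence of level \<open>k\<close> if \<open>\<sigma>\<^sub>j \<theta>\<^sup>k(X)\<close> meets \<open>\<theta>\<^sup>k(X)\<close>, and let \<open>e\<^sub>k\<close> be
  the number of coincidences modulo \<open>Q\<^sup>k \<int>\<^sup>d\<close>. By minimality every coincidence occurs at every point of
  \<open>\<theta>\<^sup>k(X)\<close>. The numbers \<open>e\<^sub>k\<close> are bounded: among too many coincidences, two would have
  desubstitutions agreeing on a large window, which forces a period (\<open>no_period_difference\<close>).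
  They are nondecreasing, because \<open>Q\<^sup>n\<close> maps coincidences of level \<open>k\<close> to coincidences of level \<open>k + n\<close>.
  Therefore \<open>e\<^bsub>2k\<^esub> = e\<^sub>k\<close> for large \<open>k\<close>, so all coincidences of level \<open>2k\<close> lie in
  \<open>Q\<^sup>k \<int>\<^sup>d\<close>. Since each coincidence of level \<open>k\<close> is congruent to one of level \<open>2k\<close> modulo
  \<open>Q\<^sup>k \<int>\<^sup>d\<close>, it lies in \<open>Q\<^sup>k \<int>\<^sup>d\<close> too, and \<open>e\<^sub>k = 1\<close> (\<open>coincidence_digits_trivial\<close>).
\<close>

section \<open>Division with remainder in the lattice\<close>

lemma vector_power_component: "(v ^ k) $ i = (v $ i) ^ k"
  for v :: "'b::comm_ring_1 ^ 'd"
  by (induction k) auto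

lemma int_div_less: "p < n * q \<Longrightarrow> 0 < q \<Longrightarrow> p div q < n" for p n q :: int
  by (smt (verit, best) mult_right_mono pos_mod_sign mult_div_mod_eq mult.commute)

lemma int_le_div: "n * q \<le> p \<Longrightarrow> 0 < q \<Longrightarrow> n \<le> p div q" for p n q :: int
  by (metis zdiv_mono1 nonzero_mult_div_cancel_right less_irrefl)

text \<open>
  The corona of the origin: the cells \<open>Q\<^sup>k w + block l k\<close> with \<open>w\<close> in this cube surround the cell at
  the origin. By \<open>Q_div_unit_cube\<close> below, knowing a configuration on this cube suffices to know its
  substituted image on the same cube, after any shift within the central cell.
\<close>

definition unit_cube :: "(int ^ 'd) set" where
  "unit_cube = {p. \<forall>i. - 1 \<le> p $ i \<and> p $ i \<le> 1}"

lemma finite_vec_box: "finite {p :: int ^ 'd. \<forall>i. a i \<le> p $ i \<and> p $ i \<le> b i}"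
proof (rule finite_subset)
  show "{p. \<forall>i. a i \<le> p $ i \<and> p $ i \<le> b i}
      \<subseteq> vec_lambda ` (\<Pi>\<^sub>E i\<in>UNIV. {a i..b i})"
  proof
    fix p :: "int ^ 'd"
    assume "p \<in> {p. \<forall>i. a i \<le> p $ i \<and> p $ i \<le> b i}"
    hence "vec_nth p \<in> (\<Pi>\<^sub>E i\<in>UNIV. {a i..b i})"
      by auto
    thus "p \<in> vec_lambda ` (\<Pi>\<^sub>E i\<in>UNIV. {a i..b i})"
      by (metis image_eqI vec_nth_inverse)
  qed
qed (intro finite_imageI finite_PiE, auto)

lemma finite_unit_cube: "finite (unit_cube :: (int ^ 'd) set)"
  using finite_vec_box[of "\<lambda>_. - 1" "\<lambda>_. 1"] by (simp add: unit_cube_def)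

lemma zero_in_unit_cube: "0 \<in> unit_cube"
  by (simp add: unit_cube_def)

locale expansion =
  fixes l :: "int ^ 'd"
  assumes l_ge_2: "\<forall>i. l $ i \<ge> 2"
begin

lemma l_power_pos: "0 < (l $ i) ^ k"
  using l_ge_2 by (meson less_le_trans zero_less_numeral zero_less_power)

lemma Q_div_mod: "l ^ k * Q_div (l ^ k) p + Q_mod (l ^ k) p = p"
  by (simp add: vec_eq_iff Q_div_def Q_mod_def)

lemma Q_mod_in_block: "Q_mod (l ^ k) p \<in> block l k"
  using l_power_pos by (simp add: block_def Q_mod_def vector_power_component)

lemma Q_div_add: "Q_div (l ^ k) (p + l ^ k * m) = Q_div (l ^ k) p + m"
  using l_power_pos[THEN less_imp_neq]
  by (auto simp add: vec_eq_iff Q_div_def vector_power_component)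

lemma Q_mod_add: "Q_mod (l ^ k) (p + l ^ k * m) = Q_mod (l ^ k) p"
  by (simp add: vec_eq_iff Q_mod_def)

lemma Q_div_block: "j \<in> block l k \<Longrightarrow> Q_div (l ^ k) j = 0"
  by (simp add: vec_eq_iff Q_div_def block_def vector_power_component)

lemma Q_mod_block: "j \<in> block l k \<Longrightarrow> Q_mod (l ^ k) j = j"
  by (simp add: vec_eq_iff Q_mod_def block_def vector_power_component)

lemma Q_div_Q_div: "Q_div (l ^ k) (Q_div l p) = Q_div (l ^ Suc k) p"
  using l_power_pos[THEN less_imp_le]
  by (simp add: vec_eq_iff Q_div_def vector_power_component zdiv_zmult2_eq)

lemma zero_in_block: "0 \<in> block l k"
  using l_power_pos by (simp add: block_def)

lemma block_0: "block l 0 = {0}"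
  by (auto simp: block_def vec_eq_iff) (smt (verit))

lemma finite_block: "finite (block l k)"
  by (rule finite_subset[OF _ finite_vec_box[of "\<lambda>_. 0" "\<lambda>i. (l $ i) ^ k"]])
    (auto simp: block_def less_imp_le)

lemma block_add:
  assumes "j \<in> block l k" "m \<in> block l n"
  shows "j + l ^ k * m \<in> block l (k + n)"
proof -
  have "0 \<le> j $ i + l $ i ^ k * m $ i \<and> j $ i + l $ i ^ k * m $ i < l $ i ^ k * l $ i ^ n" for i
  proof -
    have j: "0 \<le> j $ i" "j $ i < l $ i ^ k" and m: "0 \<le> m $ i" "m $ i + 1 \<le> l $ i ^ n"
      using assms by (auto simp: block_def add1_zle_eq)
    have "l $ i ^ k * (m $ i + 1) \<le> l $ i ^ k * l $ i ^ n"
      using m l_power_pos by (intro mult_left_mono) (auto simp: less_imp_le)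
    thus ?thesis
      using j m l_power_pos[of i k] by (simp add: distrib_left)
  qed
  thus ?thesis
    by (simp add: block_def power_add vector_power_component)
qed

lemma Q_div_in_block:
  assumes "p \<in> block l (k + n)"
  shows "Q_div (l ^ k) p \<in> block l n"
proof -
  have "0 \<le> p $ i div l $ i ^ k \<and> p $ i div l $ i ^ k < l $ i ^ n" for i
  proof -
    have "0 \<le> p $ i" "p $ i < l $ i ^ n * l $ i ^ k"
      using assms by (auto simp: block_def power_add mult.commute)
    thus ?thesis
      using l_power_pos[of i k] by (simp add: pos_imp_zdiv_nonneg_iff int_div_less)
  qed
  thus ?thesis
    by (simp add: block_def Q_div_def vector_power_component)
qed

lemma block_cong_imp_eq:
  assumes "j \<in> block l k" "j' \<in> block l k" "j = j' + l ^ k * m"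
  shows "j = j'"
  using assms Q_mod_block Q_mod_add by metis

lemma Q_div_in_unit_cube:
  assumes "j \<in> block l k" "\<forall>i. \<bar>p $ i\<bar> \<le> l $ i ^ k"
  shows "Q_div (l ^ k) (p + j) \<in> unit_cube"
proof -
  have "- 1 \<le> (p $ i + j $ i) div l $ i ^ k \<and> (p $ i + j $ i) div l $ i ^ k \<le> 1" for i
  proof -
    have "- 1 * l $ i ^ k \<le> p $ i + j $ i" "p $ i + j $ i < 2 * l $ i ^ k"
      using assms by (auto simp: block_def abs_le_iff) (smt (verit))+
    hence "(p $ i + j $ i) div l $ i ^ k < 2" "- 1 \<le> (p $ i + j $ i) div l $ i ^ k"
      using l_power_pos[of i k] by (blast intro: int_div_less int_le_div)+
    thus ?thesis
      by simp
  qed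
  thus ?thesis
    by (simp add: unit_cube_def Q_div_def vector_power_component)
qed

lemma Q_div_unit_cube:
  assumes "j \<in> block l k" "w \<in> unit_cube"
  shows "Q_div (l ^ k) (w + j) \<in> unit_cube"
proof (rule Q_div_in_unit_cube[OF assms(1)], intro allI)
  fix i
  have "\<bar>w $ i\<bar> \<le> 1"
    using assms(2) by (auto simp: unit_cube_def abs_le_iff minus_le_iff)
  thus "\<bar>w $ i\<bar> \<le> l $ i ^ k"
    using l_power_pos[of i k] by linarith
qed

lemma mem_coset: "p \<in> j +o Q_lattice l k \<longleftrightarrow> (\<exists>m. p = j + l ^ k * m)"
  by (auto simp: elt_set_plus_def Q_lattice_def)

lemma coset_eq:
  assumes "j \<in> j' +o Q_lattice l k"
  shows "j +o Q_lattice l k = j' +o Q_lattice l k"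
proof -
  obtain m where j: "j = j' + l ^ k * m"
    using assms mem_coset by blast
  have "p \<in> j +o Q_lattice l k \<longleftrightarrow> p \<in> j' +o Q_lattice l k" for p
  proof
    assume "p \<in> j +o Q_lattice l k"
    then obtain n where "p = j + l ^ k * n"
      using mem_coset by blast
    hence "p = j' + l ^ k * (m + n)"
      using j by (simp add: algebra_simps)
    thus "p \<in> j' +o Q_lattice l k"
      using mem_coset by blast
  next
    assume "p \<in> j' +o Q_lattice l k"
    then obtain n where "p = j' + l ^ k * n"
      using mem_coset by blast
    hence "p = j + l ^ k * (n - m)"
      using j by (simp add: algebra_simps)
    thus "p \<in> j +o Q_lattice l k"
      using mem_coset by blast
  qed
  thus ?thesis
    by blast
qed

end

section \<open>Compactness of configuration space\<close>

text \<open>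
  Compactness of the space of configurations over a finite alphabet, for arbitrary proper
  filters: fix the coordinates one at a time in an enumeration of the index set; at each step one of
  the finitely many letters is taken frequently along the filter.
\<close>

lemma cluster_point:
  fixes f :: "'k \<Rightarrow> 'i::countable \<Rightarrow> 'a::finite"
  assumes "F \<noteq> bot"
  shows "\<exists>x. \<forall>G. finite G \<longrightarrow> (\<exists>\<^sub>F k in F. \<forall>i\<in>G. f k i = x i)"
proof -
  define near where "near n x = (\<exists>\<^sub>F k in F. \<forall>i. to_nat i < n \<longrightarrow> f k i = x i)" for n x
  have step: "\<exists>y. near (Suc n) y \<and> (\<forall>i. to_nat i < n \<longrightarrow> y i = x i)" if "near n x" for n x
  proof (cases "\<exists>i0 :: 'i. to_nat i0 = n")
    case True
    then obtain i0 :: 'i where i0: "to_nat i0 = n"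
      by blast
    have less: "to_nat i < Suc n \<longleftrightarrow> to_nat i < n \<or> i = i0" for i
      using i0 by (metis inj_to_nat injD less_Suc_eq)
    have "\<exists>\<^sub>F k in F. \<exists>a\<in>UNIV. (\<forall>i. to_nat i < n \<longrightarrow> f k i = x i) \<and> f k i0 = a"
      using that unfolding near_def by simp
    hence "\<exists>a\<in>UNIV. \<exists>\<^sub>F k in F. (\<forall>i. to_nat i < n \<longrightarrow> f k i = x i) \<and> f k i0 = a"
      by (rule frequently_bex_finite[rotated]) simp
    then obtain a where a: "\<exists>\<^sub>F k in F. (\<forall>i. to_nat i < n \<longrightarrow> f k i = x i) \<and> f k i0 = a"
      by blast
    have "near (Suc n) (x(i0 := a))"
      unfolding near_def by (rule frequently_elim1[OF a]) (auto simp: less)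
    thus ?thesis
      using i0 by (intro exI[of _ "x(i0 := a)"]) auto
  next
    case False
    hence "to_nat i < Suc n \<longleftrightarrow> to_nat i < n" for i :: 'i
      by (metis less_Suc_eq)
    thus ?thesis
      using that by (intro exI[of _ x]) (simp add: near_def)
  qed
  have "near 0 undefined"
    using assms by (simp add: near_def)
  then obtain X where X: "\<And>n. near n (X n)" "\<And>n i. to_nat i < n \<Longrightarrow> X (Suc n) i = X n i"
    using dependent_nat_choice[of near "\<lambda>n x y. \<forall>i. to_nat i < n \<longrightarrow> y i = x i"] step by metis
  define x where "x i = X (Suc (to_nat i)) i" for i
  have X_eq: "X n i = x i" if "to_nat i < n" for n i
    using that
  proof (induction n)
    case (Suc n)
    thus ?case
      using X(2)[of i n] by (cases "to_nat i = n") (auto simp: x_def)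
  qed simp
  have "\<exists>\<^sub>F k in F. \<forall>i\<in>G. f k i = x i" if "finite G" for G
  proof -
    define n where "n = Suc (Max (to_nat ` G))"
    have n: "to_nat i < n" if "i \<in> G" for i
      using that \<open>finite G\<close> by (simp add: n_def less_Suc_eq_le)
    show ?thesis
      using X(1)[of n] unfolding near_def
      by (rule frequently_elim1) (use n X_eq in auto)
  qed
  thus ?thesis
    by blast
qed

text \<open>
  The form for families indexed by finite windows: near any window the limit agrees with some \<open>f F\<close>
  with \<open>F\<close> as large as desired, so properties that \<open>f F\<close> has on \<open>F\<close> pass to the limit.
\<close>

lemma cluster_point_directed:
  fixes f :: "'i set \<Rightarrow> 'i::countable \<Rightarrow> 'a::finite"
  shows "\<exists>y. \<forall>G H. finite G \<longrightarrow> finite H \<longrightarrow> (\<exists>F. finite F \<and> H \<subseteq> F \<and> (\<forall>i\<in>G. f F i = y i))"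
proof -
  obtain y where y: "\<And>G. finite G \<Longrightarrow> \<exists>\<^sub>F F in finite_subsets_at_top UNIV. \<forall>i\<in>G. f F i = y i"
    using cluster_point[of "finite_subsets_at_top UNIV" f] by auto
  have "\<exists>F. finite F \<and> H \<subseteq> F \<and> (\<forall>i\<in>G. f F i = y i)" if "finite G" "finite H" for G H
  proof -
    have "\<forall>\<^sub>F F in finite_subsets_at_top UNIV. finite F \<and> H \<subseteq> F"
      using that by (auto simp: eventually_finite_subsets_at_top)
    thus ?thesis
      using frequently_eventually_frequently[OF y[OF that(1)], THEN frequently_ex] by blast
  qed
  thus ?thesis
    by blast
qed

section \<open>Block substitutions and their shifts\<close>

locale substitution = expansion l
  for l :: "int ^ 'd" +
  fixes \<theta> :: "'a::finite \<Rightarrow> int ^ 'd \<Rightarrow> 'a"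
begin

abbreviation S :: "(int ^ 'd \<Rightarrow> 'a) \<Rightarrow> int ^ 'd \<Rightarrow> 'a" where
  "S \<equiv> subst_conf l \<theta>"

abbreviation X :: "(int ^ 'd \<Rightarrow> 'a) set" where
  "X \<equiv> subst_shift l \<theta>"

lemma shift_shift [simp]: "shift m (shift n y) = shift (m + n) y"
  by (simp add: shift_def fun_eq_iff add.assoc)

lemma shift_0 [simp]: "shift 0 y = y"
  by (simp add: shift_def)

lemma shift_apply: "shift n y p = y (p + n)"
  by (simp add: shift_def)

lemma shift_diff:
  assumes "shift p u = shift q v"
  shows "shift (p - q) u = v"
proof -
  have "shift (- q) (shift p u) = shift (- q) (shift q v)"
    using assms by simp
  thus ?thesis
    by simp
qed

lemma col_eq: "col l \<theta> k p a = (S ^^ k) (\<lambda>_. a) p"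
  by (induction k arbitrary: p) (simp_all add: subst_conf_def)

lemma S_apply: "S y p = \<theta> (y (Q_div l p)) (Q_mod l p)"
  by (simp add: subst_conf_def)

text \<open>
  A value of \<open>\<theta>\<^sup>k(y)\<close> depends on one letter of \<open>y\<close> only. Every transfer of a local agreement
  between configurations to their substituted images goes through this lemma.
\<close>

lemma S_power_local:
  "y (Q_div (l ^ k) p) = y' (Q_div (l ^ k) p) \<Longrightarrow> (S ^^ k) y p = (S ^^ k) y' p"
proof (induction k arbitrary: p)
  case 0
  thus ?case
    by (simp add: Q_div_def vec_lambda_eta flip: vec_eq_iff)
next
  case (Suc k)
  thus ?case
    by (simp only: funpow.simps comp_apply S_apply Q_div_Q_div)
qed

lemma S_shift: "S (shift m y) = shift (l * m) (S y)"
  using Q_div_add[of 1] Q_mod_add[of 1]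
  by (simp add: fun_eq_iff S_apply shift_apply add.commute)

lemma S_power_shift: "(S ^^ k) (shift m y) = shift (l ^ k * m) ((S ^^ k) y)"
  by (induction k) (simp_all add: S_shift mult.assoc)

text \<open>
  With \<open>col_eq\<close>, the columns disappear from the description of the shift: its elements look locally
  like iterated images of constant configurations.
\<close>

lemma subst_shift_iff:
  "x \<in> X \<longleftrightarrow>
    (\<forall>F. finite F \<longrightarrow> (\<exists>k a t. \<forall>i\<in>F. i + t \<in> block l k \<and> x i = (S ^^ k) (\<lambda>_. a) (i + t)))"
  by (simp add: subst_shift_def col_eq)

lemma subst_shift_closed:
  assumes "\<And>F. finite F \<Longrightarrow> \<exists>y\<in>X. \<forall>i\<in>F. x i = y i"
  shows "x \<in> X"
  unfolding subst_shift_iff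
proof (intro allI impI)
  fix F :: "(int ^ 'd) set"
  assume "finite F"
  then obtain y where "y \<in> X" "\<forall>i\<in>F. x i = y i"
    using assms by blast
  thus "\<exists>k a t. \<forall>i\<in>F. i + t \<in> block l k \<and> x i = (S ^^ k) (\<lambda>_. a) (i + t)"
    using \<open>finite F\<close> by (simp add: subst_shift_iff)
qed

lemma shift_in_X:
  assumes "x \<in> X"
  shows "shift n x \<in> X"
  unfolding subst_shift_iff
proof (intro allI impI)
  fix F :: "(int ^ 'd) set"
  assume "finite F"
  hence "finite ((\<lambda>i. i + n) ` F)"
    by simp
  then obtain k a t where
    "\<forall>i\<in>(\<lambda>i. i + n) ` F. i + t \<in> block l k \<and> x i = (S ^^ k) (\<lambda>_. a) (i + t)"
    using assms unfolding subst_shift_iff by blast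
  hence "\<forall>i\<in>F. i + (n + t) \<in> block l k \<and> shift n x i = (S ^^ k) (\<lambda>_. a) (i + (n + t))"
    by (simp add: shift_apply add.assoc)
  thus "\<exists>k a t. \<forall>i\<in>F. i + t \<in> block l k \<and> shift n x i = (S ^^ k) (\<lambda>_. a) (i + t)"
    by blast
qed

lemma block_Suc: "p \<in> block l (Suc k) \<longleftrightarrow> Q_div l p \<in> block l k"
  using Q_div_in_block[of p 1 k] block_add[OF Q_mod_in_block[of 1 p], of "Q_div l p" k] Q_div_mod[of 1 p]
  by (auto simp: add.commute)

lemma S_in_X:
  assumes "x \<in> X"
  shows "S x \<in> X"
  unfolding subst_shift_iff
proof (intro allI impI)
  fix F :: "(int ^ 'd) set"
  assume "finite F"
  hence "finite (Q_div l ` F)"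
    by simp
  then obtain k a t where
    "\<forall>i\<in>Q_div l ` F. i + t \<in> block l k \<and> x i = (S ^^ k) (\<lambda>_. a) (i + t)"
    using assms unfolding subst_shift_iff by blast
  hence "\<forall>i\<in>F. i + l * t \<in> block l (Suc k) \<and> S x i = (S ^^ Suc k) (\<lambda>_. a) (i + l * t)"
    using Q_div_add[of 1] Q_mod_add[of 1] by (simp add: S_apply block_Suc)
  thus "\<exists>k a t. \<forall>i\<in>F. i + t \<in> block l k \<and> S x i = (S ^^ k) (\<lambda>_. a) (i + t)"
    by blast
qed

lemma S_power_in_X: "x \<in> X \<Longrightarrow> (S ^^ k) x \<in> X"
  by (induction k) (auto intro: S_in_X)

text \<open>
  The set \<open>\<theta>\<^sup>k(X)\<close> is closed, being the continuous image of a compact set.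
\<close>

lemma S_power_image_closed:
  assumes "\<And>F. finite F \<Longrightarrow> \<exists>y\<in>X. \<forall>i\<in>F. v i = (S ^^ k) y i"
  shows "\<exists>y\<in>X. v = (S ^^ k) y"
proof -
  obtain f where f: "\<And>F. finite F \<Longrightarrow> f F \<in> X" "\<And>F. finite F \<Longrightarrow> \<forall>i\<in>F. v i = (S ^^ k) (f F) i"
    using assms by metis
  obtain y where near:
    "\<And>G H. finite G \<Longrightarrow> finite H \<Longrightarrow> \<exists>F. finite F \<and> H \<subseteq> F \<and> (\<forall>i\<in>G. f F i = y i)"
    using cluster_point_directed[of f] by blast
  have "y \<in> X"
  proof (rule subst_shift_closed)
    fix G :: "(int ^ 'd) set"
    assume "finite G"
    then obtain F where "finite F" "\<forall>i\<in>G. f F i = y i"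
      using near[of G "{}"] by blast
    thus "\<exists>z\<in>X. \<forall>i\<in>G. y i = z i"
      using f(1) by metis
  qed
  moreover have "v i = (S ^^ k) y i" for i
  proof -
    obtain F where F: "{i} \<subseteq> F" "finite F" "\<forall>p\<in>{Q_div (l ^ k) i}. f F p = y p"
      using near[of "{Q_div (l ^ k) i}" "{i}"] by blast
    have "v i = (S ^^ k) (f F) i"
      using f(2) F by blast
    also have "\<dots> = (S ^^ k) y i"
      using F(3) by (intro S_power_local) simp
    finally show ?thesis .
  qed
  ultimately show ?thesis
    by blast
qed

text \<open>
  Every point of the shift is a shifted substitution image. A large window of \<open>x\<close> lies in some
  \<open>\<theta>\<^bsup>n+1\<^esup>(a) = \<theta>(\<theta>\<^sup>n(a))\<close>, which exhibits a preimage on a smaller window; the offset takes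
  finitely many values, so one value serves all windows, and the preimages on growing windows
  accumulate by compactness.
\<close>

lemma desubstitute:
  assumes "x \<in> X"
  shows "\<exists>j\<in>block l 1. \<exists>y\<in>X. x = shift j (S y)"
proof -
  define legal where "legal F y = (\<exists>k a t. \<forall>i\<in>F. i + t \<in> block l k \<and> y i = (S ^^ k) (\<lambda>_. a) (i + t))"
    for F y
  define good where "good j F y = (legal F y \<and> (\<forall>i\<in>F. x i = S y (i + j)))" for j F y
  have good_ex: "\<exists>j\<in>block l 1. \<exists>y. good j F y" if "finite F" for F
  proof -
    \<comment> \<open>The points \<open>0\<close> and \<open>1\<close> force a block of positive level. The points \<open>l * i\<close> make the preimage
      legal on \<open>F\<close>.\<close>
    define G where "G = insert 0 (insert 1 (F \<union> (*) l ` F))"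
    have "finite G"
      using that by (simp add: G_def)
    then obtain k a t where kat: "\<forall>i\<in>G. i + t \<in> block l k \<and> x i = (S ^^ k) (\<lambda>_. a) (i + t)"
      using assms unfolding subst_shift_iff by blast
    have "k \<noteq> 0"
    proof
      assume "k = 0"
      moreover have "0 + t \<in> block l k" "1 + t \<in> block l k"
        using kat by (simp_all add: G_def)
      ultimately have "t = 0" "1 + t = 0"
        by (simp_all add: block_0)
      thus False
        by simp
    qed
    then obtain n where k: "k = Suc n"
      using not0_implies_Suc by blast
    define y where "y = shift (Q_div l t) ((S ^^ n) (\<lambda>_. a))"
    have t: "t = Q_mod l t + l * Q_div l t"
      using Q_div_mod[of 1 t] by (simp add: add.commute)
    have "i + Q_div l t \<in> block l n" if "i \<in> F" for i
    proof -
      have "l * i + t \<in> block l (Suc n)"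
        using kat k that by (simp add: G_def)
      thus ?thesis
        using Q_div_add[of 1 t i] by (simp add: block_Suc add.commute)
    qed
    hence "legal F y"
      unfolding legal_def y_def shift_apply by blast
    moreover have "x i = S y (i + Q_mod l t)" if "i \<in> F" for i
    proof -
      have "x i = S ((S ^^ n) (\<lambda>_. a)) (i + t)"
        using kat k that by (simp add: G_def)
      also have "\<dots> = S y (i + Q_mod l t)"
        by (subst t) (simp add: y_def S_shift shift_apply add.assoc)
      finally show ?thesis .
    qed
    ultimately show ?thesis
      using Q_mod_in_block[of 1 t] unfolding good_def by auto
  qed
  have "\<exists>j\<in>block l 1. \<forall>F. finite F \<longrightarrow> (\<exists>y. good j F y)"
  proof (rule ccontr)
    assume "\<not> ?thesis"
    then obtain H where H: "\<And>j. j \<in> block l 1 \<Longrightarrow> finite (H j) \<and> \<not> (\<exists>y. good j (H j) y)"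
      by metis
    have "finite (\<Union>j\<in>block l 1. H j)"
      using H finite_block by blast
    then obtain j y where jy: "j \<in> block l 1" "good j (\<Union>j\<in>block l 1. H j) y"
      using good_ex by blast
    hence "good j (H j) y"
      unfolding good_def legal_def by (meson UN_I)
    thus False
      using H jy(1) by blast
  qed
  then obtain j f where j: "j \<in> block l 1" and f: "\<And>F. finite F \<Longrightarrow> good j F (f F)"
    by metis
  obtain y where near:
    "\<And>G H. finite G \<Longrightarrow> finite H \<Longrightarrow> \<exists>F. finite F \<and> H \<subseteq> F \<and> (\<forall>i\<in>G. f F i = y i)"
    using cluster_point_directed[of f] by blast
  have "y \<in> X"
    unfolding subst_shift_iff
  proof (intro allI impI)
    fix G :: "(int ^ 'd) set"
    assume "finite G"
    then obtain F where F: "finite F" "G \<subseteq> F" "\<forall>i\<in>G. f F i = y i"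
      using near[of G G] by blast
    have "legal F (f F)"
      using f F by (simp add: good_def)
    thus "\<exists>k a t. \<forall>i\<in>G. i + t \<in> block l k \<and> y i = (S ^^ k) (\<lambda>_. a) (i + t)"
      unfolding legal_def using F(2,3) by (metis subsetD)
  qed
  moreover have "x i = S y (i + j)" for i
  proof -
    obtain F where F: "finite F" "{i} \<subseteq> F" "\<forall>p\<in>{Q_div l (i + j)}. f F p = y p"
      using near[of "{Q_div l (i + j)}" "{i}"] by blast
    have "x i = S (f F) (i + j)"
      using f F unfolding good_def by blast
    also have "\<dots> = S y (i + j)"
      using F(3) by (simp add: S_apply)
    finally show ?thesis .
  qed
  ultimately show ?thesis
    using j by (auto simp: shift_def)
qed

lemma desubstitute_power:
  assumes "x \<in> X"
  shows "\<exists>j\<in>block l k. \<exists>y\<in>X. x = shift j ((S ^^ k) y)"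
proof (induction k)
  case 0
  show ?case
    using assms zero_in_block[of 0] by (intro bexI[of _ 0] bexI[of _ x]) auto
next
  case (Suc k)
  then obtain j y where j: "j \<in> block l k" "y \<in> X" "x = shift j ((S ^^ k) y)"
    by blast
  obtain i z where i: "i \<in> block l 1" "z \<in> X" "y = shift i (S z)"
    using desubstitute j(2) by blast
  have "x = shift (j + l ^ k * i) ((S ^^ Suc k) z)"
    using j i by (simp add: S_power_shift funpow_swap1)
  moreover have "j + l ^ k * i \<in> block l (Suc k)"
    using block_add[OF j(1) i(1)] by simp
  ultimately show ?case
    using i(2) by blast
qed

end

section \<open>Uniform recurrence of patterns\<close>

locale primitive_substitution = substitution l \<theta>
  for l :: "int ^ 'd" and \<theta> :: "'a::finite \<Rightarrow> int ^ 'd \<Rightarrow> 'a" +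
  assumes primitive: "primitive l \<theta>"
begin

text \<open>
  Primitivity gives bounded gaps: a pattern inside \<open>\<theta>\<^sup>k(a)\<close> occurs in each
  \<open>\<theta>\<^bsup>k+K\<^esup>(b)\<close>, and every point of the shift is tiled by such blocks, the one at the origin
  being displaced by an element of \<open>block l (k + K)\<close>.
\<close>

lemma pattern_recurs:
  assumes "finite F" "y \<in> X"
  shows "\<exists>M. finite M \<and> (\<forall>x\<in>X. \<exists>m\<in>M. \<forall>i\<in>F. x (i + m) = y i)"
proof -
  obtain K where K: "\<And>a b. \<exists>j\<in>block l K. (S ^^ K) (\<lambda>_. a) j = b"
    using primitive by (auto simp: primitive_def col_eq)
  obtain k a t where kat: "\<forall>i\<in>F. i + t \<in> block l k \<and> y i = (S ^^ k) (\<lambda>_. a) (i + t)"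
    using assms unfolding subst_shift_iff by blast
  define M where "M = (\<lambda>(j, j'). l ^ k * j' + t - j) ` (block l (k + K) \<times> block l K)"
  have "\<exists>m\<in>M. \<forall>i\<in>F. x (i + m) = y i" if "x \<in> X" for x
  proof -
    obtain j z where j: "j \<in> block l (k + K)" "x = shift j ((S ^^ (k + K)) z)"
      using desubstitute_power \<open>x \<in> X\<close> by blast
    obtain j' where j': "j' \<in> block l K" "(S ^^ K) (\<lambda>_. z 0) j' = a"
      using K by blast
    have a: "(S ^^ K) z j' = a"
      using S_power_local[of z K j' "\<lambda>_. z 0"] j' by (simp add: Q_div_block)
    have "x (i + (l ^ k * j' + t - j)) = y i" if "i \<in> F" for i
    proof -
      have "x (i + (l ^ k * j' + t - j)) = (S ^^ k) (shift j' ((S ^^ K) z)) (i + t)"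
        unfolding j(2) funpow_add comp_apply shift_apply S_power_shift
        by (simp add: algebra_simps)
      also have "\<dots> = (S ^^ k) (\<lambda>_. a) (i + t)"
        using kat that a by (intro S_power_local) (simp add: Q_div_block shift_apply)
      finally show ?thesis
        using kat that by simp
    qed
    thus ?thesis
      using j(1) j'(1) unfolding M_def by force
  qed
  moreover have "finite M"
    by (simp add: M_def finite_block)
  ultimately show ?thesis
    by blast
qed

lemma patterns_finite:
  assumes "finite F"
  shows "finite ((\<lambda>y :: int ^ 'd \<Rightarrow> 'a. restrict y F) ` Y)"
proof (rule finite_subset)
  show "(\<lambda>y. restrict y F) ` Y \<subseteq> F \<rightarrow>\<^sub>E UNIV"
    by auto
  show "finite (F \<rightarrow>\<^sub>E (UNIV :: 'a set))"
    using assms by (intro finite_PiE) auto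
qed

lemma patterns_recur:
  assumes "finite F"
  shows "\<exists>M. finite M \<and> (\<forall>x\<in>X. \<forall>y\<in>X. \<exists>m\<in>M. \<forall>i\<in>F. x (i + m) = y i)"
proof -
  define P where "P = (\<lambda>y. restrict y F) ` X"
  have "\<exists>M. finite M \<and> (\<forall>x\<in>X. \<exists>m\<in>M. \<forall>i\<in>F. x (i + m) = p i)" if p: "p \<in> P" for p
  proof -
    obtain y where "y \<in> X" "p = restrict y F"
      using p unfolding P_def by blast
    thus ?thesis
      using pattern_recurs[OF assms, of y] by (simp cong: ball_cong)
  qed
  hence "\<forall>p\<in>P. \<exists>M. finite M \<and> (\<forall>x\<in>X. \<exists>m\<in>M. \<forall>i\<in>F. x (i + m) = p i)"
    by simp
  from bchoice[OF this] obtain M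
    where M: "\<forall>p\<in>P. finite (M p) \<and> (\<forall>x\<in>X. \<exists>m\<in>M p. \<forall>i\<in>F. x (i + m) = p i)" ..
  have "finite P"
    using patterns_finite[OF assms] unfolding P_def .
  hence "finite (\<Union>p\<in>P. M p)"
    using M by (intro finite_UN_I) simp_all
  moreover have "\<exists>m\<in>(\<Union>p\<in>P. M p). \<forall>i\<in>F. x (i + m) = y i" if "x \<in> X" "y \<in> X" for x y
  proof -
    have y: "restrict y F \<in> P"
      using that by (simp add: P_def)
    have "\<forall>x\<in>X. \<exists>m\<in>M (restrict y F). \<forall>i\<in>F. x (i + m) = restrict y F i"
      by (rule conjunct2[OF bspec[OF M y]])
    hence "\<exists>m\<in>M (restrict y F). \<forall>i\<in>F. x (i + m) = y i"
      using that(1) by simp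
    then obtain m where "m \<in> M (restrict y F)" "\<forall>i\<in>F. x (i + m) = y i" ..
    thus ?thesis
      using y by (intro bexI[of _ m] UN_I[of "restrict y F"])
  qed
  ultimately show ?thesis
    by blast
qed

end

section \<open>Recognisability\<close>

locale aperiodic_substitution = primitive_substitution l \<theta>
  for l :: "int ^ 'd" and \<theta> :: "'a::finite \<Rightarrow> int ^ 'd \<Rightarrow> 'a" +
  assumes aperiodic: "aperiodic l \<theta>"
begin

text \<open>
  The only place where aperiodicity enters. Suppose two distinct offsets of \<open>x\<close> at level \<open>k\<close> led to
  desubstitutions \<open>y\<close>, \<open>y'\<close> that agree on a window \<open>M\<close> meeting all patterns of unit cube shape. Then
  \<open>x\<close> would agree with its translate by \<open>v = j' - j\<close> on the whole window \<open>Q\<^sup>k M\<close>. As \<open>v\<close> is at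
  most as long as a level \<open>k\<close> block, any two positions \<open>p\<close>, \<open>p + v\<close> of any point of the shift lie in
  the substituted image of a unit cube pattern, and this image recurs in the window \<open>Q\<^sup>k M\<close>. So
  \<open>v\<close> would be a period. The window \<open>M\<close> does not depend on \<open>k\<close>.
\<close>

lemma no_period_difference:
  assumes M: "\<forall>x\<in>X. \<forall>y\<in>X. \<exists>m\<in>M. \<forall>i\<in>unit_cube. x (i + m) = y i"
    and j: "j \<in> block l k" "j' \<in> block l k"
    and y: "y \<in> X" "y' \<in> X" and eq: "shift j x = (S ^^ k) y" "shift j' x = (S ^^ k) y'"
    and agree: "\<forall>m\<in>M. y m = y' m"
  shows "j = j'"
proof -
  define v where "v = j' - j"
  have v: "\<forall>i. \<bar>v $ i\<bar> \<le> l $ i ^ k"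
    using j by (auto simp: v_def block_def abs_le_iff) (smt (verit))+
  have x: "(S ^^ k) y (p + v) = (S ^^ k) y p" if "Q_div (l ^ k) p \<in> M" for p
  proof -
    have "(S ^^ k) y p = (S ^^ k) y' p"
      using agree that by (intro S_power_local) blast
    also have "\<dots> = x (p + j')"
      using eq(2)[symmetric] by (simp add: shift_apply)
    also have "\<dots> = shift j x (p + v)"
      by (simp add: shift_apply v_def algebra_simps)
    finally show ?thesis
      using eq(1) by simp
  qed
  \<comment> \<open>By shift invariance it suffices to compare the values of an arbitrary point at \<open>0\<close> and \<open>v\<close>.\<close>
  have period_at_0: "u 0 = u v" if u: "u \<in> X" for u
  proof -
    obtain i z where i: "i \<in> block l k" "z \<in> X" "u = shift i ((S ^^ k) z)"
      using desubstitute_power u by blast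
    obtain m where m: "m \<in> M" "\<forall>w\<in>unit_cube. y (w + m) = z w"
      using M y(1) i(2) by blast
    have copy: "(S ^^ k) z p = (S ^^ k) y (p + l ^ k * m)" if "Q_div (l ^ k) p \<in> unit_cube" for p
    proof -
      have "(S ^^ k) z p = (S ^^ k) (shift m y) p"
        using m that by (intro S_power_local) (simp add: shift_apply)
      thus ?thesis
        by (simp add: S_power_shift shift_apply)
    qed
    have "u 0 = (S ^^ k) z i"
      using i(3) by (simp add: shift_apply)
    also have "\<dots> = (S ^^ k) y (i + l ^ k * m)"
      using i(1) by (intro copy) (simp add: Q_div_block zero_in_unit_cube)
    also have "\<dots> = (S ^^ k) y (i + l ^ k * m + v)"
      using i(1) m(1) by (intro x[symmetric]) (simp add: Q_div_add Q_div_block)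
    also have "\<dots> = (S ^^ k) y (v + i + l ^ k * m)"
      by (simp add: algebra_simps)
    also have "\<dots> = (S ^^ k) z (v + i)"
      using Q_div_in_unit_cube[OF i(1) v] by (intro copy[symmetric])
    also have "\<dots> = u v"
      using i(3) by (simp add: shift_apply)
    finally show ?thesis .
  qed
  have "shift v y = y"
  proof
    fix p
    show "shift v y p = y p"
      using period_at_0[OF shift_in_X[OF y(1), of p]] by (simp add: shift_apply add.commute)
  qed
  hence "v = 0"
    using aperiodic y(1) unfolding aperiodic_def by blast
  thus ?thesis
    by (simp add: v_def)
qed

text \<open>
  The set of obstructions to recognisability at level \<open>k\<close>: the displacements by which \<open>\<theta>\<^sup>k(X)\<close>
  meets itself. The aim is to show that it is only \<open>Q\<^sup>k \<int>\<^sup>d\<close>.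
\<close>

definition coincidences :: "nat \<Rightarrow> (int ^ 'd) set" where
  "coincidences k = {j. \<exists>y\<in>X. \<exists>y'\<in>X. shift j ((S ^^ k) y) = (S ^^ k) y'}"

text \<open>
  By minimality of the shift, one coincidence propagates to all points: near any finite window, \<open>u\<close>
  looks like a translate of the configuration \<open>y\<close> whose image coincides with a displaced one.
\<close>

lemma coincidence_everywhere:
  assumes "j \<in> coincidences k" "u \<in> X"
  shows "\<exists>u'\<in>X. shift j ((S ^^ k) u) = (S ^^ k) u'"
proof (rule S_power_image_closed)
  fix F :: "(int ^ 'd) set"
  assume "finite F"
  obtain y y' where y: "y \<in> X" "y' \<in> X" "shift j ((S ^^ k) y) = (S ^^ k) y'"
    using assms(1) by (auto simp: coincidences_def)
  define G where "G = (\<lambda>i. Q_div (l ^ k) (i + j)) ` F"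
  have "finite G"
    using \<open>finite F\<close> by (simp add: G_def)
  then obtain m where m: "\<forall>i\<in>G. y (i + m) = u i"
    using pattern_recurs[of G u] assms(2) y(1) by blast
  have "shift j ((S ^^ k) u) i = (S ^^ k) (shift m y') i" if "i \<in> F" for i
  proof -
    have "shift j ((S ^^ k) u) i = (S ^^ k) (shift m y) (i + j)"
      unfolding shift_apply using m that by (intro S_power_local) (simp add: G_def shift_apply)
    also have "\<dots> = shift j ((S ^^ k) y) (i + l ^ k * m)"
      by (simp add: S_power_shift shift_apply algebra_simps)
    also have "\<dots> = (S ^^ k) (shift m y') i"
      unfolding y(3) by (simp add: S_power_shift shift_apply)
    finally show ?thesis .
  qed
  thus "\<exists>z\<in>X. \<forall>i\<in>F. shift j ((S ^^ k) u) i = (S ^^ k) z i"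
    using shift_in_X[OF y(2)] by blast
qed

lemma coincidences_add:
  assumes "j \<in> coincidences k"
  shows "j + l ^ k * m \<in> coincidences k"
proof -
  obtain y y' where y: "y \<in> X" "y' \<in> X" "shift j ((S ^^ k) y) = (S ^^ k) y'"
    using assms by (auto simp: coincidences_def)
  have "shift (l ^ k * m) (shift j ((S ^^ k) y)) = shift (l ^ k * m) ((S ^^ k) y')"
    using y(3) by simp
  hence "shift (j + l ^ k * m) ((S ^^ k) y) = (S ^^ k) (shift m y')"
    by (simp add: S_power_shift add.commute)
  thus ?thesis
    using y shift_in_X[OF y(2)] unfolding coincidences_def by blast
qed

lemma Q_mod_coincidences: "j \<in> coincidences k \<Longrightarrow> Q_mod (l ^ k) j \<in> coincidences k"
  using coincidences_add[of j k "- Q_div (l ^ k) j"] Q_div_mod[of k j, symmetric]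
  by (metis add_uminus_conv_diff add_diff_cancel_left' mult_minus_right)

lemma coincidences_scale:
  assumes "j \<in> coincidences k"
  shows "l ^ n * j \<in> coincidences (n + k)"
proof -
  obtain y y' where y: "y \<in> X" "y' \<in> X" "shift j ((S ^^ k) y) = (S ^^ k) y'"
    using assms by (auto simp: coincidences_def)
  have "shift (l ^ n * j) ((S ^^ (n + k)) y) = (S ^^ (n + k)) y'"
    using y(3) by (simp add: funpow_add flip: S_power_shift)
  thus ?thesis
    using y unfolding coincidences_def by blast
qed

abbreviation coincidence_digits :: "nat \<Rightarrow> (int ^ 'd) set" where
  "coincidence_digits k \<equiv> coincidences k \<inter> block l k"

lemma scale_coincidence_digits:
  "(*) (l ^ n) ` coincidence_digits k \<subseteq> coincidence_digits (n + k)"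
proof
  fix p
  assume "p \<in> (*) (l ^ n) ` coincidence_digits k"
  then obtain j where "j \<in> coincidence_digits k" "p = l ^ n * j"
    by blast
  thus "p \<in> coincidence_digits (n + k)"
    using coincidences_scale[of j k n] block_add[OF zero_in_block, of j k n] by simp
qed

lemma inj_scale: "inj ((*) (l ^ n))"
proof (rule injI)
  fix p q
  assume "l ^ n * p = l ^ n * q"
  hence "l $ i ^ n * p $ i = l $ i ^ n * q $ i" for i
    by (metis vector_mult_component vector_power_component)
  hence "p $ i = q $ i" for i
    using l_power_pos[of i n] by (metis less_irrefl mult_cancel_left)
  thus "p = q"
    by (simp add: vec_eq_iff)
qed

lemma card_coincidence_digits_mono: "card (coincidence_digits k) \<le> card (coincidence_digits (n + k))"
proof -
  have "card (coincidence_digits k) = card ((*) (l ^ n) ` coincidence_digits k)"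
    using inj_scale by (metis card_image inj_on_subset subset_UNIV)
  also have "\<dots> \<le> card (coincidence_digits (n + k))"
    using scale_coincidence_digits finite_block by (intro card_mono) auto
  finally show ?thesis .
qed

text \<open>
  All displacements in the block can be realised at the single point \<open>\<theta>\<^sup>k(x)\<close>. By
  \<open>no_period_difference\<close> different displacements lead to desubstitutions that differ on the window
  \<open>M\<close>, so their number is at most that of the patterns on \<open>M\<close>, for every \<open>k\<close>.
\<close>

lemma coincidence_digits_bounded:
  assumes "x \<in> X"
  shows "\<exists>N. \<forall>k. card (coincidence_digits k) \<le> N"
proof -
  obtain M where fin: "finite M"
    and M: "\<forall>x\<in>X. \<forall>y\<in>X. \<exists>m\<in>M. \<forall>i\<in>unit_cube. x (i + m) = y i"
    using patterns_recur[OF finite_unit_cube] by blast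
  define P :: "(int ^ 'd \<Rightarrow> 'a) set" where "P = (\<lambda>y. restrict y M) ` X"
  have "finite P"
    unfolding P_def using fin by (rule patterns_finite)
  have "card (coincidence_digits k) \<le> card P" for k
  proof -
    have "\<forall>j\<in>coincidence_digits k. \<exists>y\<in>X. shift j ((S ^^ k) x) = (S ^^ k) y"
      using coincidence_everywhere assms by blast
    then obtain f where f: "\<forall>j\<in>coincidence_digits k. f j \<in> X \<and> shift j ((S ^^ k) x) = (S ^^ k) (f j)"
      by metis
    have "inj_on (\<lambda>j. restrict (f j) M) (coincidence_digits k)"
    proof (rule inj_onI)
      fix i j
      assume ij: "i \<in> coincidence_digits k" "j \<in> coincidence_digits k"
        "restrict (f i) M = restrict (f j) M"
      have "\<forall>m\<in>M. f i m = f j m"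
        using ij(3) by (metis restrict_apply')
      thus "i = j"
        using no_period_difference[OF M, of i k j "f i" "f j" "(S ^^ k) x"] f ij(1,2) by simp
    qed
    moreover have "(\<lambda>j. restrict (f j) M) ` coincidence_digits k \<subseteq> P"
      using f by (auto simp: P_def)
    ultimately show ?thesis
      using \<open>finite P\<close> by (rule card_inj_on_le)
  qed
  thus ?thesis
    by blast
qed

lemma zero_coincidence: "x \<in> X \<Longrightarrow> 0 \<in> coincidence_digits k"
  unfolding coincidences_def using zero_in_block by auto

text \<open>
  Multiplication by \<open>Q\<^sup>k\<close> embeds the coincidences of level \<open>k\<close> into those of level \<open>2k\<close>. If the
  numbers agree, all coincidences of level \<open>2k\<close> lie in \<open>Q\<^sup>k \<int>\<^sup>d\<close>. But a coincidence \<open>h\<close> of level \<open>k\<close>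
  becomes one of level \<open>2k\<close> when a multiple \<open>Q\<^sup>k j\<close> is subtracted: desubstitute once more by \<open>k\<close>
  levels. Hence \<open>h\<close> itself lies in \<open>Q\<^sup>k \<int>\<^sup>d\<close>.
\<close>

lemma coincidence_digits_stationary:
  assumes "x \<in> X" and stat: "card (coincidence_digits (k + k)) = card (coincidence_digits k)"
  shows "coincidence_digits k = {0}"
proof -
  have "(*) (l ^ k) ` coincidence_digits k = coincidence_digits (k + k)"
  proof (rule card_subset_eq)
    show "finite (coincidence_digits (k + k))"
      using finite_block by blast
    show "card ((*) (l ^ k) ` coincidence_digits k) = card (coincidence_digits (k + k))"
      unfolding stat using inj_scale by (metis card_image inj_on_subset subset_UNIV)
  qed (rule scale_coincidence_digits)
  hence scaled: "r \<in> coincidence_digits (k + k) \<Longrightarrow> \<exists>g. r = l ^ k * g" for r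
    by blast
  have "h = 0" if h: "h \<in> coincidence_digits k" for h
  proof -
    obtain y where y: "y \<in> X" "shift h ((S ^^ k) ((S ^^ k) x)) = (S ^^ k) y"
      using coincidence_everywhere S_power_in_X[OF assms(1)] h by blast
    obtain j z where j: "z \<in> X" "y = shift j ((S ^^ k) z)"
      using desubstitute_power[OF y(1)] by blast
    have "shift h ((S ^^ (k + k)) x) = shift (l ^ k * j) ((S ^^ (k + k)) z)"
      using y(2) j(2) by (simp add: funpow_add S_power_shift)
    hence "shift (h - l ^ k * j) ((S ^^ (k + k)) x) = (S ^^ (k + k)) z"
      by (rule shift_diff)
    hence "h - l ^ k * j \<in> coincidences (k + k)"
      using assms(1) j(1) unfolding coincidences_def by blast
    then obtain g where "Q_mod (l ^ (k + k)) (h - l ^ k * j) = l ^ k * g"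
      using Q_mod_coincidences Q_mod_in_block scaled by blast
    hence "h - l ^ k * j = l ^ k * (l ^ k * Q_div (l ^ (k + k)) (h - l ^ k * j) + g)"
      using Q_div_mod[of "k + k" "h - l ^ k * j"] by (simp add: power_add algebra_simps)
    hence "h = 0 + l ^ k * (l ^ k * Q_div (l ^ (k + k)) (h - l ^ k * j) + g + j)"
      by (simp add: algebra_simps)
    thus ?thesis
      using block_cong_imp_eq[OF _ zero_in_block] h by blast
  qed
  thus ?thesis
    using zero_coincidence[OF assms(1)] by blast
qed

text \<open>
  The numbers of coincidences form a bounded nondecreasing sequence, which is constant from some level
  on; there the previous lemma applies, and by monotonicity its conclusion descends to all levels.
\<close>

lemma coincidence_digits_trivial:
  assumes "x \<in> X"
  shows "coincidence_digits k = {0}"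
proof -
  define e where "e k = card (coincidence_digits k)" for k
  obtain b where "\<forall>k. e k \<le> b"
    using coincidence_digits_bounded[OF assms] unfolding e_def by blast
  hence "finite (range e)"
    unfolding finite_nat_set_iff_bounded_le by blast
  hence "Max (range e) \<in> range e" and max: "e m \<le> Max (range e)" for m
    by (auto intro: Max_in)
  then obtain n where n: "Max (range e) = e n"
    by blast
  have mono: "e i \<le> e (m + i)" for i m
    unfolding e_def by (rule card_coincidence_digits_mono)
  \<comment> \<open>A level that is at least \<open>k\<close> and from which on \<open>e\<close> is constant.\<close>
  define N where "N = k + n"
  have "e N = e n" "e (N + N) = e n"
    using max[of N] max[of "N + N"] mono[of n k] mono[of N N] by (simp_all add: n N_def)
  hence "e N = 1"
    using coincidence_digits_stationary[OF assms, of N] by (simp add: e_def)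
  hence "e k \<le> 1"
    using mono[of k n] by (simp add: N_def add.commute)
  moreover have "finite (coincidence_digits k)"
    using finite_block by blast
  ultimately have "\<forall>i\<in>coincidence_digits k. \<forall>j\<in>coincidence_digits k. i = j"
    unfolding e_def by (simp only: card_le_Suc0_iff_eq One_nat_def)
  thus ?thesis
    using zero_coincidence[OF assms, of k] by blast
qed

text \<open>
  Two offsets of the same point at level \<open>k\<close> differ by a coincidence, and those are trivial.
\<close>

lemma recognisable:
  assumes "x \<in> X" "y \<in> X" "y' \<in> X"
    and "x = shift j ((S ^^ k) y)" "x = shift j' ((S ^^ k) y')"
  shows "j \<in> j' +o Q_lattice l k"
proof -
  have "shift (j - j') ((S ^^ k) y) = (S ^^ k) y'"
    using assms(4,5) by (intro shift_diff) simp
  hence "j - j' \<in> coincidences k"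
    using assms(2,3) unfolding coincidences_def by blast
  hence "Q_mod (l ^ k) (j - j') = 0"
    using Q_mod_coincidences[of "j - j'" k] Q_mod_in_block[of k "j - j'"]
      coincidence_digits_trivial[OF assms(1), of k] by blast
  hence "j = j' + l ^ k * Q_div (l ^ k) (j - j')"
    using Q_div_mod[of k "j - j'"] by (simp add: algebra_simps)
  thus ?thesis
    using mem_coset by blast
qed

lemma odometer_map_eq:
  assumes "x \<in> X" "y \<in> X" "x = shift j ((S ^^ k) y)"
  shows "odometer_map l \<theta> x k = j +o Q_lattice l k"
proof -
  obtain i z where i: "i \<in> block l k" "z \<in> X" "x = shift i ((S ^^ k) z)"
    using desubstitute_power assms(1) by blast
  have "(THE i. i \<in> block l k \<and> (\<exists>y\<in>X. x = shift i ((S ^^ k) y))) = i"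
  proof (rule the_equality)
    fix i'
    assume i': "i' \<in> block l k \<and> (\<exists>y\<in>X. x = shift i' ((S ^^ k) y))"
    hence "i' \<in> i +o Q_lattice l k"
      using recognisable assms(1) i by blast
    thus "i' = i"
      using mem_coset block_cong_imp_eq i' i(1) by blast
  qed (use i in blast)
  hence "odometer_map l \<theta> x k = i +o Q_lattice l k"
    by (simp add: odometer_map_def)
  thus ?thesis
    using coset_eq[OF recognisable[OF assms(1) i(2) assms(2) i(3) assms(3)]] by simp
qed

lemma mem_fibre_iff:
  assumes "\<And>k. z k = J k +o Q_lattice l k"
  shows "x \<in> fibre l \<theta> z \<longleftrightarrow> x \<in> X \<and> (\<forall>k. \<exists>y\<in>X. x = shift (J k) ((S ^^ k) y))"
proof
  assume x: "x \<in> fibre l \<theta> z"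
  hence "x \<in> X" and z: "odometer_map l \<theta> x = z"
    by (auto simp: fibre_def)
  have "\<exists>y\<in>X. x = shift (J k) ((S ^^ k) y)" for k
  proof -
    obtain j y where j: "y \<in> X" "x = shift j ((S ^^ k) y)"
      using desubstitute_power \<open>x \<in> X\<close> by blast
    have "J k +o Q_lattice l k = j +o Q_lattice l k"
      using odometer_map_eq[OF \<open>x \<in> X\<close> j] by (simp add: z assms)
    moreover have "J k \<in> J k +o Q_lattice l k"
      unfolding mem_coset by (intro exI[of _ 0]) simp
    ultimately obtain m where "J k = j + l ^ k * m"
      using mem_coset by blast
    hence "x = shift (J k) ((S ^^ k) (shift (- m) y))"
      using j(2) by (simp add: S_power_shift)
    thus ?thesis
      using shift_in_X[OF j(1)] by blast
  qed
  thus "x \<in> X \<and> (\<forall>k. \<exists>y\<in>X. x = shift (J k) ((S ^^ k) y))"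
    using \<open>x \<in> X\<close> by blast
next
  assume x: "x \<in> X \<and> (\<forall>k. \<exists>y\<in>X. x = shift (J k) ((S ^^ k) y))"
  have "odometer_map l \<theta> x k = z k" for k
    using x odometer_map_eq assms by metis
  thus "x \<in> fibre l \<theta> z"
    using x by (auto simp: fibre_def)
qed

end

section \<open>Digits of odometer points\<close>

context expansion
begin

abbreviation address :: "(nat \<Rightarrow> int ^ 'd) \<Rightarrow> nat \<Rightarrow> int ^ 'd" where
  "address w k \<equiv> \<Sum>i<k. l ^ i * w i"

lemma address_add: "address w (k + n) = address w k + l ^ k * address (\<lambda>i. w (k + i)) n"
  by (induction n) (simp_all add: algebra_simps power_add)

lemma address_in_block:
  assumes "\<And>i. w i \<in> block l 1"
  shows "address w k \<in> block l k"
proof (induction k)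
  case (Suc k)
  thus ?case
    using block_add[OF Suc assms[of k]] by simp
qed (simp add: zero_in_block)

text \<open>
  The digits of an odometer point: the representatives \<open>j\<^sub>k\<close> of its cosets in \<open>block l k\<close> satisfy
  \<open>j\<^bsub>k+1\<^esub> \<equiv> j\<^sub>k\<close> modulo \<open>Q\<^sup>k \<int>\<^sup>d\<close>, and the quotient of their difference by \<open>Q\<^sup>k\<close> is the digit of
  index \<open>k\<close>.
\<close>

lemma odometer_digits:
  assumes "z \<in> odometer l"
  shows "\<exists>w. (\<forall>i. w i \<in> block l 1) \<and> z = of_digits l w"
proof -
  have "\<exists>j. j \<in> block l k \<and> z k = j +o Q_lattice l k" for k
  proof -
    obtain m where m: "z k = m +o Q_lattice l k"
      using assms unfolding odometer_def by blast
    have "m \<in> Q_mod (l ^ k) m +o Q_lattice l k"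
      unfolding mem_coset using Q_div_mod[of k m] by (metis add.commute)
    thus ?thesis
      using m coset_eq Q_mod_in_block by blast
  qed
  then obtain j where j: "\<And>k. j k \<in> block l k" "\<And>k. z k = j k +o Q_lattice l k"
    by metis
  define w where "w k = Q_div (l ^ k) (j (Suc k))" for k
  have step: "j (Suc k) = j k + l ^ k * w k" for k
  proof -
    have "j (Suc k) \<in> j (Suc k) +o Q_lattice l (Suc k)"
      unfolding mem_coset by (intro exI[of _ 0]) simp
    moreover have "z (Suc k) \<subseteq> z k"
      using assms by (auto simp: odometer_def)
    ultimately obtain m where "j (Suc k) = j k + l ^ k * m"
      unfolding j(2) using mem_coset by blast
    hence "Q_mod (l ^ k) (j (Suc k)) = j k"
      by (simp add: Q_mod_add Q_mod_block j(1))
    thus ?thesis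
      using Q_div_mod[of k "j (Suc k)"] by (simp add: w_def add.commute)
  qed
  have "address w k = j k" for k
  proof (induction k)
    case 0
    show ?case
      using j(1)[of 0] by (simp add: block_0)
  qed (simp add: step)
  hence "z = of_digits l w"
    by (simp add: fun_eq_iff of_digits_def j(2))
  moreover have "w i \<in> block l 1" for i
    unfolding w_def using j(1)[of "Suc i"] by (intro Q_div_in_block) simp
  ultimately show ?thesis
    by blast
qed

lemma translate_coset: "n +o (j +o Q_lattice l k) = (n + j) +o Q_lattice l k"
  by (rule set_plus_rearrange2)

text \<open>
  Translations by \<open>\<int>\<^sup>d\<close> can replace any finite initial segment of digits by any other one.
\<close>

lemma change_digits:
  assumes "\<And>i. k \<le> i \<Longrightarrow> w' i = w i"
  shows "odometer_translate (of_digits l w) (address w' k - address w k) = of_digits l w'"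
proof
  fix K
  define n where "n = address w' k - address w k"
  have "n + address w K \<in> address w' K +o Q_lattice l K"
  proof (cases "k \<le> K")
    case True
    then obtain r where "K = k + r"
      using le_Suc_ex by blast
    hence "n + address w K = address w' K + l ^ K * 0"
      by (simp add: n_def address_add assms)
    thus ?thesis
      unfolding mem_coset by blast
  next
    case False
    then obtain r where "k = K + r"
      using le_Suc_ex nat_le_linear by blast
    hence "n + address w K = address w' K +
        l ^ K * (address (\<lambda>i. w' (K + i)) r - address (\<lambda>i. w (K + i)) r)"
      unfolding n_def \<open>k = K + r\<close> address_add by (simp add: right_diff_distrib)
    thus ?thesis
      unfolding mem_coset by blast
  qed
  thus "odometer_translate (of_digits l w) (address w' k - address w k) K = of_digits l w' K"
    unfolding n_def by (simp only: odometer_translate_def of_digits_def translate_coset coset_eq)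
qed

end

section \<open>Paths in finite labelled graphs\<close>

lemma path_labels_extend_backwards:
  assumes pred: "\<And>P. P \<in> C \<Longrightarrow> \<exists>b. \<exists>P'\<in>C. (P', b, P) \<in> E"
    and "V k \<in> C" "\<And>i. k \<le> i \<Longrightarrow> (V i, w i, V (Suc i)) \<in> E"
  shows "\<exists>w'\<in>path_labels E. \<forall>i\<ge>k. w' i = w i"
  using assms(2,3)
proof (induction k arbitrary: V w)
  case 0
  hence "w \<in> path_labels E"
    by (auto simp: path_labels_def)
  thus ?case
    by blast
next
  case (Suc k)
  obtain b P where P: "P \<in> C" "(P, b, V (Suc k)) \<in> E"
    using pred[OF Suc.prems(1)] by blast
  have "(V(k := P)) k \<in> C"
    using P(1) by simp
  moreover have "((V(k := P)) i, (w(k := b)) i, (V(k := P)) (Suc i)) \<in> E" if "k \<le> i" for i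
    using that P(2) Suc.prems(2)[of i] by (cases "i = k") auto
  ultimately have "\<exists>w'\<in>path_labels E. \<forall>i\<ge>k. w' i = (w(k := b)) i"
    by (rule Suc.IH)
  then obtain w' where w': "w' \<in> path_labels E" "\<forall>i\<ge>k. w' i = (w(k := b)) i" ..
  have "\<forall>i\<ge>Suc k. w' i = w i"
    using w'(2) by auto
  thus ?case
    using w'(1) by blast
qed

text \<open>
  In a finite graph an infinite path visits some vertex twice. Backwards from that vertex one can walk
  around the resulting cycle for as long as desired; this provides a prefix of exactly the length
  needed to turn a path that starts at a late time into one that starts at time \<open>0\<close>.
\<close>

lemma path_labels_from_tail:
  assumes "finite (range V)" "\<And>i. k \<le> i \<Longrightarrow> (V i, w i, V (Suc i)) \<in> E"
  shows "\<exists>n. \<exists>w'\<in>path_labels E. \<forall>i\<ge>n. w' i = w i"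
proof -
  have "\<not> inj_on V {k..}"
    using assms(1) by (metis finite_imageD finite_subset image_mono infinite_Ici top_greatest)
  then obtain a b where "k \<le> a" "k \<le> b" "a \<noteq> b" "V a = V b"
    by (auto simp: inj_on_def)
  then obtain m n where mn: "k \<le> m" "m < n" "V m = V n"
    by (metis nat_neq_iff)
  have "\<exists>b. \<exists>P'\<in>V ` {m..<n}. (P', b, P) \<in> E" if P: "P \<in> V ` {m..<n}" for P
  proof -
    obtain i where i: "m \<le> i" "i < n" "P = V i"
      using P by auto
    \<comment> \<open>The predecessor of \<open>V m\<close> on the cycle is \<open>V (n - 1)\<close>, because \<open>V m = V n\<close>.\<close>
    define i' where "i' = (if i = m then n else i) - 1"
    have "V (Suc i') = P" "i' \<in> {m..<n}"
      using i mn by (auto simp: i'_def)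
    moreover have "(V i', w i', V (Suc i')) \<in> E"
      using \<open>i' \<in> {m..<n}\<close> mn(1) by (intro assms(2)) simp
    ultimately show ?thesis
      by blast
  qed
  moreover have "V m \<in> V ` {m..<n}"
    using mn(2) by (intro imageI) simp
  ultimately have "\<exists>w'\<in>path_labels E. \<forall>i\<ge>m. w' i = w i"
    by (rule path_labels_extend_backwards) (use assms(2) mn(1) in auto)
  thus ?thesis
    by blast
qed

lemma sofic_path_labels:
  fixes E :: "('v \<times> 'b \<times> 'v) set"
  assumes "finite E" "\<And>u b v. (u, b, v) \<in> E \<Longrightarrow> b \<in> B"
  shows "sofic B (path_labels E)"
proof -
  define U where "U = (\<lambda>(u, b, v). u) ` E \<union> (\<lambda>(u, b, v). v) ` E"
  have U: "u \<in> U" "v \<in> U" if "(u, b, v) \<in> E" for u b v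
    using that by (force simp: U_def)+
  have "finite U"
    using assms(1) by (simp add: U_def)
  then obtain f :: "'v \<Rightarrow> nat" where f: "inj_on f U"
    using finite_imp_inj_to_nat_seg by metis
  define E' where "E' = (\<lambda>(u, b, v). (f u, b, f v)) ` E"
  have "path_labels E = path_labels E'"
  proof (intro subset_antisym subsetI)
    fix w
    assume "w \<in> path_labels E"
    then obtain v where "\<And>k. (v k, w k, v (Suc k)) \<in> E"
      by (auto simp: path_labels_def)
    hence "(f (v k), w k, f (v (Suc k))) \<in> E'" for k
      unfolding E'_def by force
    thus "w \<in> path_labels E'"
      unfolding path_labels_def by (intro CollectI exI[of _ "\<lambda>k. f (v k)"]) simp
  next
    fix w
    assume "w \<in> path_labels E'"
    then obtain v where v: "\<And>k. (v k, w k, v (Suc k)) \<in> E'"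
      by (auto simp: path_labels_def)
    have "(inv_into U f (v k), w k, inv_into U f (v (Suc k))) \<in> E" for k
    proof -
      obtain a b c where abc: "(a, b, c) \<in> E" "(v k, w k, v (Suc k)) = (f a, b, f c)"
        using v[of k] unfolding E'_def by force
      thus ?thesis
        using U[OF abc(1)] f by simp
    qed
    thus "w \<in> path_labels E"
      unfolding path_labels_def by (intro CollectI exI[of _ "\<lambda>k. inv_into U f (v k)"]) simp
  qed
  moreover have "finite E'" "\<forall>(u, b, v)\<in>E'. b \<in> B"
    using assms by (auto simp: E'_def)
  ultimately show ?thesis
    unfolding sofic_def by blast
qed

section \<open>Fibres and the graph of crops\<close>

context aperiodic_substitution
begin

lemma mem_translated_fibre:
  assumes "z \<in> odometer l"
  shows "x \<in> fibre l \<theta> (odometer_translate z n) \<longleftrightarrow> shift (- n) x \<in> fibre l \<theta> z"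
proof -
  obtain w where w: "z = of_digits l w"
    using odometer_digits[OF assms] by blast
  have z: "z k = address w k +o Q_lattice l k" for k
    by (simp add: w of_digits_def)
  hence nz: "odometer_translate z n k = (n + address w k) +o Q_lattice l k" for k
    by (simp only: odometer_translate_def translate_coset)
  have "x = shift (n + j) y \<longleftrightarrow> shift (- n) x = shift j y" for j y
    by (metis add.left_inverse add.right_inverse shift_0 shift_shift)
  moreover have "x \<in> X \<longleftrightarrow> shift (- n) x \<in> X"
    using shift_in_X[of x "- n"] shift_in_X[of "shift (- n) x" n] by auto
  ultimately show ?thesis
    by (simp only: mem_fibre_iff[of z, OF z] mem_fibre_iff[of "odometer_translate z n", OF nz])
qed

lemma irregular_translate:
  assumes "z \<in> odometer l"
  shows "irregular l \<theta> (odometer_translate z n) \<longleftrightarrow> irregular l \<theta> z"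
proof -
  have "bij_betw (shift (- n)) (fibre l \<theta> (odometer_translate z n)) (fibre l \<theta> z)"
    using mem_translated_fibre[OF assms]
    by (intro bij_betw_byWitness[where f' = "shift n"]) auto
  thus ?thesis
    unfolding irregular_def by (metis bij_betw_finite bij_betw_same_card)
qed

abbreviation crop :: "(int ^ 'd \<Rightarrow> 'a) \<Rightarrow> int ^ 'd \<Rightarrow> 'a" where
  "crop y \<equiv> restrict y unit_cube"

lemma crop_eq_iff: "crop y = crop y' \<longleftrightarrow> (\<forall>p\<in>unit_cube. y p = y' p)"
  by (auto simp: fun_eq_iff restrict_def)

lemma crop_subst:
  assumes "j \<in> block l k" "crop y = crop y'"
  shows "crop (shift j ((S ^^ k) y)) = crop (shift j ((S ^^ k) y'))"
  unfolding crop_eq_iff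
proof
  fix p :: "int ^ 'd"
  assume "p \<in> unit_cube"
  hence "Q_div (l ^ k) (p + j) \<in> unit_cube"
    by (rule Q_div_unit_cube[OF assms(1)])
  thus "shift j ((S ^^ k) y) p = shift j ((S ^^ k) y') p"
    unfolding shift_apply using assms(2) by (intro S_power_local) (auto simp: crop_eq_iff)
qed

text \<open>
  By \<open>crop_subst\<close> the action of \<open>\<sigma>\<^sub>n \<circ> \<theta>\<close> on configurations descends to crops; this is the
  induced map.
\<close>

definition induced :: "int ^ 'd \<Rightarrow> (int ^ 'd \<Rightarrow> 'a) \<Rightarrow> int ^ 'd \<Rightarrow> 'a" where
  "induced n p = crop (shift n (S p))"

lemma induced_crop: "n \<in> block l 1 \<Longrightarrow> induced n (crop y) = crop (shift n (S y))"
  unfolding induced_def using crop_subst[of n 1 "crop y" y] by simp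

text \<open>
  The vertices on edges are the sets of \<open>c\<close> crops of points of the shift. Since both endpoints of an
  edge have \<open>c\<close> elements, \<open>induced n\<close> is injective on its target: substitution keeps the \<open>c\<close> crops
  distinct. Edges run from the substituted set to the preimage set, so that a path reads the
  digits from the lowest one upwards.
\<close>

definition graph :: "nat \<Rightarrow>
    ((int ^ 'd \<Rightarrow> 'a) set \<times> (int ^ 'd) \<times> (int ^ 'd \<Rightarrow> 'a) set) set" where
  "graph c = {(P, n, P'). n \<in> block l 1 \<and> P = induced n ` P' \<and>
      P \<subseteq> crop ` X \<and> P' \<subseteq> crop ` X \<and> card P = c \<and> card P' = c}"

lemma finite_graph: "finite (graph c)"
proof (rule finite_subset)
  show "graph c \<subseteq> Pow (crop ` X) \<times> block l 1 \<times> Pow (crop ` X)"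
    by (auto simp: graph_def)
  show "finite (Pow (crop ` X) \<times> block l 1 \<times> Pow (crop ` X))"
    using patterns_finite[OF finite_unit_cube] finite_block by blast
qed

text \<open>
  Desubstituting one level at a time gives a coherent tower of preimages of \<open>x\<close>. By recognisability
  the offset of each step is forced to be the corresponding digit of \<open>\<pi>(x)\<close>.
\<close>

lemma desubstitution_sequence:
  assumes w: "\<And>i. w i \<in> block l 1" and x: "x \<in> fibre l \<theta> (of_digits l w)"
  shows "\<exists>y. \<forall>k. y k \<in> X \<and> x = shift (address w k) ((S ^^ k) (y k)) \<and> y k = shift (w k) (S (y (Suc k)))"
proof -
  have "x \<in> X" and levels: "\<exists>y\<in>X. x = shift (address w k) ((S ^^ k) y)" for k
    using x mem_fibre_iff[of "of_digits l w" "address w"] by (auto simp: of_digits_def)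
  have step: "\<exists>y'. (y' \<in> X \<and> x = shift (address w (Suc k)) ((S ^^ Suc k) y')) \<and> y = shift (w k) (S y')"
    if y: "y \<in> X \<and> x = shift (address w k) ((S ^^ k) y)" for y k
  proof -
    obtain j y' where j: "j \<in> block l 1" "y' \<in> X" "y = shift j (S y')"
      using desubstitute y by blast
    have x': "x = shift (address w k + l ^ k * j) ((S ^^ Suc k) y')"
      using y j(3) by (simp add: S_power_shift funpow_swap1)
    obtain y'' where "y'' \<in> X" "x = shift (address w (Suc k)) ((S ^^ Suc k) y'')"
      using levels by blast
    hence "address w k + l ^ k * j \<in> address w (Suc k) +o Q_lattice l (Suc k)"
      using recognisable[OF \<open>x \<in> X\<close> j(2) _ x'] by blast
    then obtain m where m: "address w k + l ^ k * j = address w (Suc k) + l ^ Suc k * m"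
      unfolding mem_coset ..
    have "address w k + l ^ k * j \<in> block l (Suc k)"
      using block_add[OF address_in_block[OF w] j(1)] by simp
    hence "address w k + l ^ k * j = address w (Suc k)"
      by (rule block_cong_imp_eq[OF _ address_in_block[OF w] m])
    hence "j = w k"
      using inj_scale[of k] by (simp add: inj_eq)
    thus ?thesis
      using j x' by (intro exI[of _ y']) simp
  qed
  have "\<exists>y. \<forall>k. (y k \<in> X \<and> x = shift (address w k) ((S ^^ k) (y k))) \<and>
      y k = shift (w k) (S (y (Suc k)))"
  proof (rule dependent_nat_choice)
    show "\<exists>y. y \<in> X \<and> x = shift (address w 0) ((S ^^ 0) y)"
      using \<open>x \<in> X\<close> by (intro exI[of _ x]) simp
  qed (rule step)
  thus ?thesis
    by (simp only: conj_assoc)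
qed

text \<open>
  Finitely many different points differ from each other at finitely many positions; once the level
  \<open>k\<close> cells are so large that the unit cube of cells around the origin covers these positions, the
  preimages of level \<open>k\<close> differ on the unit cube.
\<close>

lemma eventually_crops_distinct:
  assumes w: "\<And>i. w i \<in> block l 1" and "finite A"
    and y: "\<And>x k. x \<in> A \<Longrightarrow> x = shift (address w k) ((S ^^ k) (y x k))"
  shows "\<exists>k0. \<forall>k\<ge>k0. inj_on (\<lambda>x. crop (y x k)) A"
proof -
  have "\<forall>(x, x')\<in>{(x, x')\<in>A \<times> A. x \<noteq> x'}. \<exists>p. x p \<noteq> x' p"
    by (auto simp: fun_eq_iff)
  then obtain d where d: "\<And>x x'. x \<in> A \<Longrightarrow> x' \<in> A \<Longrightarrow> x \<noteq> x' \<Longrightarrow> x (d x x') \<noteq> x' (d x x')"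
    by (metis ext)
  \<comment> \<open>As \<open>k \<le> 2\<^sup>k \<le> \<ell>\<^sub>i\<^sup>k\<close>, any bound on the coordinates of the positions is a sufficient level.\<close>
  define B where "B = (\<lambda>(x, x', i). nat \<bar>d x x' $ i\<bar>) ` (A \<times> A \<times> UNIV)"
  have "finite B"
    using \<open>finite A\<close> by (simp add: B_def)
  then obtain k0 where k0: "\<forall>b\<in>B. b \<le> k0"
    using finite_nat_set_iff_bounded_le by blast
  have "inj_on (\<lambda>x. crop (y x k)) A" if "k0 \<le> k" for k
  proof (rule inj_onI, rule ccontr)
    fix x x'
    assume x: "x \<in> A" "x' \<in> A" "crop (y x k) = crop (y x' k)" "x \<noteq> x'"
    define p where "p = d x x'"
    have "\<bar>p $ i\<bar> \<le> l $ i ^ k" for i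
    proof -
      have "nat \<bar>p $ i\<bar> \<in> B"
        unfolding B_def p_def using x(1,2) by (intro image_eqI[of _ _ "(x, x', i)"]) auto
      hence "nat \<bar>p $ i\<bar> \<le> k"
        using k0 that by (meson order_trans)
      also have "k \<le> 2 ^ k"
        by (simp add: less_imp_le)
      finally have "\<bar>p $ i\<bar> \<le> 2 ^ k"
        by (simp add: nat_le_iff)
      also have "\<dots> \<le> l $ i ^ k"
        using l_ge_2 by (intro power_mono) auto
      finally show ?thesis .
    qed
    hence "Q_div (l ^ k) (p + address w k) \<in> unit_cube"
      by (intro Q_div_in_unit_cube address_in_block w allI)
    hence "(S ^^ k) (y x k) (p + address w k) = (S ^^ k) (y x' k) (p + address w k)"
      using x(3) by (intro S_power_local) (simp add: crop_eq_iff)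
    hence "x p = x' p"
      using y[OF x(1), of k] y[OF x(2), of k] by (metis shift_apply)
    thus False
      using d[OF x(1,2,4)] by (simp add: p_def)
  qed
  thus ?thesis
    by blast
qed

text \<open>
  The crops of the preimages of \<open>A\<close> form a path in the graph, but only from the level on where they
  are distinct. Below that level the word \<open>w\<close> has to be changed.
\<close>

lemma fibre_points_give_path:
  assumes w: "\<And>i. w i \<in> block l 1" and A: "A \<subseteq> fibre l \<theta> (of_digits l w)" "finite A"
  shows "\<exists>n. \<exists>w'\<in>path_labels (graph (card A)). \<forall>i\<ge>n. w' i = w i"
proof -
  have "\<forall>x\<in>A. \<exists>y. \<forall>k. y k \<in> X \<and> x = shift (address w k) ((S ^^ k) (y k)) \<and>
      y k = shift (w k) (S (y (Suc k)))"
  proof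
    fix x
    assume "x \<in> A"
    thus "\<exists>y. \<forall>k. y k \<in> X \<and> x = shift (address w k) ((S ^^ k) (y k)) \<and> y k = shift (w k) (S (y (Suc k)))"
      using A(1) by (intro desubstitution_sequence w) blast
  qed
  from bchoice[OF this] obtain y where
    choice: "\<forall>x\<in>A. \<forall>k. y x k \<in> X \<and> x = shift (address w k) ((S ^^ k) (y x k)) \<and>
      y x k = shift (w k) (S (y x (Suc k)))" ..
  have y: "y x k \<in> X" "x = shift (address w k) ((S ^^ k) (y x k))"
      "y x k = shift (w k) (S (y x (Suc k)))" if "x \<in> A" for x k
    using bspec[OF choice that] by (blast, blast, blast)
  obtain k0 where k0: "\<forall>k\<ge>k0. inj_on (\<lambda>x. crop (y x k)) A"
    using eventually_crops_distinct[of w A y, OF w A(2) y(2)] by blast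
  define V where "V k = (\<lambda>x. crop (y x k)) ` A" for k
  have V: "V k \<subseteq> crop ` X" for k
    using y(1) by (auto simp: V_def)
  have card_V: "card (V k) = card A" if "k0 \<le> k" for k
    unfolding V_def using k0 that by (intro card_image) blast
  have step: "V k = induced (w k) ` V (Suc k)" for k
    unfolding V_def image_image
  proof (rule image_cong[OF refl])
    fix x
    assume "x \<in> A"
    show "crop (y x k) = induced (w k) (crop (y x (Suc k)))"
      unfolding induced_crop[OF w] by (subst y(3)[OF \<open>x \<in> A\<close>]) (rule refl)
  qed
  have "(V k, w k, V (Suc k)) \<in> graph (card A)" if "k0 \<le> k" for k
    unfolding graph_def mem_Collect_eq case_prod_conv using that
    by (intro conjI w step V card_V) simp_all
  moreover have "finite (range V)"
  proof (rule finite_subset)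
    show "range V \<subseteq> Pow (crop ` X)"
      using V by blast
    show "finite (Pow (crop ` X))"
      unfolding finite_Pow_iff using finite_unit_cube by (rule patterns_finite)
  qed
  ultimately show ?thesis
    by (intro path_labels_from_tail)
qed

lemma path_point_ancestor:
  assumes V: "\<And>k. (V k, w k, V (Suc k)) \<in> graph c" and p: "p \<in> V 0"
  shows "\<exists>y\<in>X. crop y \<in> V k \<and> crop (shift (address w k) ((S ^^ k) y)) = p"
proof (induction k)
  case 0
  obtain y where y: "y \<in> X" "p = crop y"
    using p V[of 0] unfolding graph_def by blast
  have "crop (shift (address w 0) ((S ^^ 0) y)) = p"
    by (simp add: y(2))
  moreover have "crop y \<in> V 0"
    using p unfolding y(2) .
  ultimately show ?case
    using y(1) by (intro bexI[of _ y] conjI)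
next
  case (Suc k)
  have w: "w i \<in> block l 1" for i
    using V[of i] by (simp add: graph_def)
  obtain y where y: "y \<in> X" "crop y \<in> V k" "crop (shift (address w k) ((S ^^ k) y)) = p"
    using Suc by blast
  then obtain q where q: "q \<in> V (Suc k)" "crop y = induced (w k) q"
    using V[of k] by (auto simp: graph_def)
  then obtain y' where y': "y' \<in> X" "q = crop y'"
    using V[of k] by (auto simp: graph_def)
  have "p = crop (shift (address w k) ((S ^^ k) (shift (w k) (S y'))))"
    unfolding y(3)[symmetric] using q(2) y'(2) induced_crop[OF w]
    by (intro crop_subst address_in_block w) simp
  also have "\<dots> = crop (shift (address w (Suc k)) ((S ^^ Suc k) y'))"
    by (simp add: S_power_shift funpow_swap1)
  finally show ?case
    using y' q(1) by blast
qed

text \<open>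
  Each crop in the starting vertex of a path is realised by a point of the fibre: its ancestors along
  the path give points that have the right crop and the right address up to level \<open>k\<close>, and these
  points accumulate by compactness.
\<close>

lemma path_gives_fibre_point:
  assumes V: "\<And>k. (V k, w k, V (Suc k)) \<in> graph c" and p: "p \<in> V 0"
  shows "\<exists>x\<in>fibre l \<theta> (of_digits l w). crop x = p"
proof -
  obtain y where y: "\<And>k. y k \<in> X" "\<And>k. crop (shift (address w k) ((S ^^ k) (y k))) = p"
    using path_point_ancestor[OF V p] by metis
  define f where "f k = shift (address w k) ((S ^^ k) (y k))" for k
  obtain x where x: "\<And>G. finite G \<Longrightarrow> \<exists>\<^sub>F k in sequentially. \<forall>i\<in>G. f k i = x i"
    using cluster_point[of sequentially f] by auto
  have near: "\<exists>k\<ge>m. \<forall>i\<in>G. f k i = x i" if "finite G" for G m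
    using x[OF that] unfolding frequently_sequentially by blast
  have "x \<in> X"
  proof (rule subst_shift_closed)
    fix G :: "(int ^ 'd) set"
    assume "finite G"
    then obtain k where "\<forall>i\<in>G. f k i = x i"
      using near by blast
    moreover have "f k \<in> X"
      unfolding f_def by (intro shift_in_X S_power_in_X y)
    ultimately show "\<exists>u\<in>X. \<forall>i\<in>G. x i = u i"
      by (intro bexI[of _ "f k"]) auto
  qed
  moreover have "\<exists>u\<in>X. x = shift (address w m) ((S ^^ m) u)" for m
  proof -
    have "\<exists>u\<in>X. shift (- address w m) x = (S ^^ m) u"
    proof (rule S_power_image_closed)
      fix G :: "(int ^ 'd) set"
      assume "finite G"
      hence "finite ((\<lambda>i. i - address w m) ` G)"
        by simp
      then obtain k where k: "m \<le> k" "\<forall>i\<in>(\<lambda>i. i - address w m) ` G. f k i = x i"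
        using near by blast
      obtain r where "k = m + r"
        using k(1) le_Suc_ex by blast
      define u where "u = shift (address (\<lambda>i. w (m + i)) r) ((S ^^ r) (y k))"
      have "f k = shift (address w m) ((S ^^ m) u)"
        by (simp add: f_def u_def S_power_shift address_add \<open>k = m + r\<close> funpow_add)
      hence "shift (- address w m) (f k) = (S ^^ m) u"
        by simp
      hence "shift (- address w m) x i = (S ^^ m) u i" if "i \<in> G" for i
        using k(2) that by (auto simp: shift_apply fun_eq_iff)
      moreover have "u \<in> X"
        unfolding u_def by (intro shift_in_X S_power_in_X y)
      ultimately show "\<exists>u\<in>X. \<forall>i\<in>G. shift (- address w m) x i = (S ^^ m) u i"
        by blast
    qed
    then obtain u where "u \<in> X" "shift (- address w m) x = (S ^^ m) u"
      by blast
    moreover have "x = shift (address w m) (shift (- address w m) x)"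
      by simp
    ultimately show ?thesis
      by metis
  qed
  ultimately have "x \<in> fibre l \<theta> (of_digits l w)"
    using mem_fibre_iff[of "of_digits l w" "address w" x] by (simp add: of_digits_def)
  moreover have "crop x = p"
  proof -
    obtain k where "\<forall>i\<in>unit_cube. f k i = x i"
      using near[OF finite_unit_cube] by blast
    hence "crop (f k) = crop x"
      by (simp add: crop_eq_iff)
    thus ?thesis
      using y(2)[of k] by (simp add: f_def)
  qed
  ultimately show ?thesis
    by blast
qed

lemma path_imp_irregular:
  assumes "w \<in> path_labels (graph (Suc (column_number l \<theta>)))"
  shows "irregular l \<theta> (of_digits l w)"
proof -
  let ?c = "Suc (column_number l \<theta>)" and ?F = "fibre l \<theta> (of_digits l w)"
  obtain V where V: "\<And>k. (V k, w k, V (Suc k)) \<in> graph ?c"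
    using assms by (auto simp: path_labels_def)
  have "V 0 \<subseteq> crop ` ?F"
    using path_gives_fibre_point[of V w, OF V] by blast
  moreover have "card (V 0) = ?c"
    using V[of 0] unfolding graph_def by blast
  ultimately have "finite ?F \<Longrightarrow> ?c \<le> card ?F"
    by (metis card_image_le card_mono finite_imageI order_trans)
  thus ?thesis
    unfolding irregular_def by linarith
qed

lemma irregular_imp_path:
  assumes w: "\<And>i. w i \<in> block l 1" and "irregular l \<theta> (of_digits l w)"
  shows "\<exists>n. \<exists>w'\<in>path_labels (graph (Suc (column_number l \<theta>))). \<forall>i\<ge>n. w' i = w i"
proof -
  let ?c = "Suc (column_number l \<theta>)"
  have "\<exists>A. A \<subseteq> fibre l \<theta> (of_digits l w) \<and> finite A \<and> card A = ?c"
  proof (cases "finite (fibre l \<theta> (of_digits l w))")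
    case True
    hence "?c \<le> card (fibre l \<theta> (of_digits l w))"
      using assms(2) by (simp add: irregular_def)
    thus ?thesis
      by (meson obtain_subset_with_card_n)
  next
    case False
    thus ?thesis
      using infinite_arbitrarily_large by blast
  qed
  then obtain A where A: "A \<subseteq> fibre l \<theta> (of_digits l w)" "finite A" "card A = ?c"
    by blast
  show ?thesis
    using fibre_points_give_path[of w, OF w A(1,2)] unfolding A(3) .
qed

end

theorem theorem3:
  fixes l :: "int ^ 'd" and \<theta> :: "'a::finite \<Rightarrow> int ^ 'd \<Rightarrow> 'a" and x :: "int ^ 'd \<Rightarrow> 'a"
  assumes "\<forall>i. l $ i \<ge> 2"
    and "primitive l \<theta>"
    and "aperiodic l \<theta>"
    and "x \<in> subst_shift l \<theta>"
    and "is_height_lattice l x UNIV"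
  shows "\<exists>Z. sofic (block l 1) Z \<and>
    (\<forall>z\<in>odometer l. irregular l \<theta> z \<longleftrightarrow>
      (\<exists>n. odometer_translate z n \<in> of_digits l ` Z))"
proof -
  interpret aperiodic_substitution l \<theta>
    by unfold_locales (use assms in auto)
  define Z where "Z = path_labels (graph (Suc (column_number l \<theta>)))"
  have "sofic (block l 1) Z"
    unfolding Z_def using finite_graph by (rule sofic_path_labels) (auto simp: graph_def)
  moreover have "irregular l \<theta> z \<longleftrightarrow> (\<exists>n. odometer_translate z n \<in> of_digits l ` Z)"
    if z: "z \<in> odometer l" for z
  proof
    assume "irregular l \<theta> z"
    moreover obtain w where "\<forall>i. w i \<in> block l 1" "z = of_digits l w"
      using odometer_digits[OF z] by blast
    ultimately obtain k w' where "w' \<in> Z" "\<forall>i\<ge>k. w' i = w i"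
      unfolding Z_def using irregular_imp_path[of w] by blast
    thus "\<exists>n. odometer_translate z n \<in> of_digits l ` Z"
      using change_digits[of k w' w] \<open>z = of_digits l w\<close> by blast
  next
    assume "\<exists>n. odometer_translate z n \<in> of_digits l ` Z"
    then obtain n w where "w \<in> Z" "odometer_translate z n = of_digits l w"
      by blast
    thus "irregular l \<theta> z"
      using path_imp_irregular irregular_translate[OF z, of n] unfolding Z_def by metis
  qed
  ultimately show ?thesis
    by blast
qed

end
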